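(* Let $\lambda/\mu$ be a skew shape with $n$ boxes ($n\ge1$) and let $\xi$ be a primitive $n$-th root of unity. Then, for $n=dm$ with positive integers $d,m$, $$\chi^{\lambda/\mu}((m^d))=f^{\lambda/\mu}(\xi^d),$$ where $(m^d)$ is the partition of $n$ with $d$ parts equal to $m$.
   Context: The skew characters $\chi^{\lambda/\mu}(\nu)$, $\nu\vdash n$, are defined by $s_{\lambda/\mu}(\mathbf{x})=\sum_{\nu\vdash n}\chi^{\lambda/\mu}(\nu)\,p_\nu(\mathbf{x})/z_\nu$, where $s_{\lambda/\mu}$ is the skew Schur function, $p_\nu$ the power sum symmetric function, and $z_\nu=\prod_j m_j!\,j^{m_j}$ with $m_j$ the number of parts of $\nu$ equal to $j$. $f^{\lambda/\mu}(q)=\sum_{T\in\mathrm{SYT}(\lambda/\mu)}q^{\mathrm{maj}(T)}$, the sum over standard Young tableaux of shape $\lambda/\mu$ (English notation), where $\mathrm{maj}(T)$ is the sum of the descents of $T$, a descent being $j\in\{1,\dots,n-1\}$ such that $j+1$ appears in a row of strictly larger index (strictly lower) than $j$. *)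

theory Defs
  imports Complex_Main "HOL-Library.FuncSet" "HOL-Library.Poly_Mapping"
begin

section \<open>Partitions and skew diagrams\<close>

definition is_partition :: "nat list \<Rightarrow> bool" where
  "is_partition \<nu> \<longleftrightarrow> sorted_wrt (\<ge>) \<nu> \<and> 0 \<notin> set \<nu>"

definition partitions_of :: "nat \<Rightarrow> nat list set" where
  "partitions_of n = {\<nu>. is_partition \<nu> \<and> sum_list \<nu> = n}"

lemma finite_partitions_of: "finite (partitions_of n)"
proof (rule finite_subset)
  have "length \<nu> \<le> sum_list \<nu>" if "0 \<notin> set \<nu>" for \<nu> :: "nat list"
    using that by (induction \<nu>) (auto simp: Suc_le_eq)
  then show "partitions_of n \<subseteq> {\<nu>. set \<nu> \<subseteq> {..n} \<and> length \<nu> \<le> n}"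
    by (auto simp: partitions_of_def is_partition_def member_le_sum_list)
  show "finite {\<nu>. set \<nu> \<subseteq> {..n} \<and> length \<nu> \<le> n}"
    by (rule finite_lists_length_le) simp
qed

text \<open>Boxes are pairs (row, column) in English notation; both coordinates start at 0, and row
  indices grow downwards.\<close>

definition diagram :: "nat list \<Rightarrow> (nat \<times> nat) set" where
  "diagram lam = {(r, c). r < length lam \<and> c < lam ! r}"

definition skew_shape :: "nat list \<Rightarrow> nat list \<Rightarrow> bool" where
  "skew_shape lam mu \<longleftrightarrow> is_partition lam \<and> is_partition mu \<and> diagram mu \<subseteq> diagram lam"

definition skew_diagram :: "nat list \<Rightarrow> nat list \<Rightarrow> (nat \<times> nat) set" where
  "skew_diagram lam mu = diagram lam - diagram mu"

lemma finite_skew_diagram: "finite (skew_diagram lam mu)"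
proof -
  have "diagram lam = (SIGMA r:{..<length lam}. {..<lam ! r})"
    by (auto simp: diagram_def)
  then show ?thesis
    by (simp add: skew_diagram_def)
qed


section \<open>Tableaux\<close>

text \<open>Fillings are extensional functions on the boxes, so that distinct functions are distinct
  tableaux.\<close>

definition SYT :: "nat list \<Rightarrow> nat list \<Rightarrow> (nat \<times> nat \<Rightarrow> nat) set" where
  "SYT lam mu = {T \<in> extensional (skew_diagram lam mu).
     bij_betw T (skew_diagram lam mu) {1..card (skew_diagram lam mu)} \<and>
     (\<forall>r c c'. (r, c) \<in> skew_diagram lam mu \<longrightarrow> (r, c') \<in> skew_diagram lam mu \<longrightarrow>
        c < c' \<longrightarrow> T (r, c) < T (r, c')) \<and>
     (\<forall>r r' c. (r, c) \<in> skew_diagram lam mu \<longrightarrow> (r', c) \<in> skew_diagram lam mu \<longrightarrow>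
        r < r' \<longrightarrow> T (r, c) < T (r', c))}"

lemma finite_SYT: "finite (SYT lam mu)"
proof (rule finite_subset)
  let ?D = "skew_diagram lam mu"
  show "SYT lam mu \<subseteq> ?D \<rightarrow>\<^sub>E {1..card ?D}"
    by (auto simp: SYT_def PiE_def bij_betw_def)
  show "finite (?D \<rightarrow>\<^sub>E {1..card ?D})"
    by (intro finite_PiE finite_skew_diagram) simp
qed

definition descents :: "nat list \<Rightarrow> nat list \<Rightarrow> (nat \<times> nat \<Rightarrow> nat) \<Rightarrow> nat set" where
  "descents lam mu T = {j \<in> {1..card (skew_diagram lam mu) - 1}.
     \<exists>r c r' c'. (r, c) \<in> skew_diagram lam mu \<and> (r', c') \<in> skew_diagram lam mu \<and>
        T (r, c) = j \<and> T (r', c') = j + 1 \<and> r < r'}"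

definition maj :: "nat list \<Rightarrow> nat list \<Rightarrow> (nat \<times> nat \<Rightarrow> nat) \<Rightarrow> nat" where
  "maj lam mu T = \<Sum>(descents lam mu T)"

definition f_skew :: "nat list \<Rightarrow> nat list \<Rightarrow> 'a \<Rightarrow> 'a::comm_semiring_1" where
  "f_skew lam mu q = (\<Sum>T\<in>SYT lam mu. q ^ maj lam mu T)"

definition SSYT :: "nat list \<Rightarrow> nat list \<Rightarrow> (nat \<times> nat \<Rightarrow> nat) set" where
  "SSYT lam mu = {T \<in> extensional (skew_diagram lam mu).
     (\<forall>r c c'. (r, c) \<in> skew_diagram lam mu \<longrightarrow> (r, c') \<in> skew_diagram lam mu \<longrightarrow>
        c < c' \<longrightarrow> T (r, c) \<le> T (r, c')) \<and>
     (\<forall>r r' c. (r, c) \<in> skew_diagram lam mu \<longrightarrow> (r', c) \<in> skew_diagram lam mu \<longrightarrow>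
        r < r' \<longrightarrow> T (r, c) < T (r', c))}"


section \<open>Symmetric functions\<close>

text \<open>A formal power series in the infinitely many variables \<open>x\<^sub>0, x\<^sub>1, \<dots>\<close> is given by its
  coefficients. The monomial with exponent \<open>\<alpha> i\<close> at \<open>x\<^sub>i\<close> is the finitely supported map \<open>\<alpha>\<close>, so
  multiplication of monomials is addition of maps.\<close>

type_synonym series = "(nat \<Rightarrow>\<^sub>0 nat) \<Rightarrow> complex"

definition series_one :: series where
  "series_one = (\<lambda>\<alpha>. if \<alpha> = 0 then 1 else 0)"

definition series_mult :: "series \<Rightarrow> series \<Rightarrow> series" where
  "series_mult F G = (\<lambda>\<alpha>. \<Sum>(\<beta>, \<gamma>) | \<beta> + \<gamma> = \<alpha>. F \<beta> * G \<gamma>)"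

lemma finite_splittings: "finite {(\<beta>, \<gamma>). \<beta> + \<gamma> = (\<alpha> :: nat \<Rightarrow>\<^sub>0 nat)}"
proof -
  let ?B = "{\<beta>. \<exists>\<gamma>. \<beta> + \<gamma> = \<alpha>}"
  let ?g = "\<lambda>\<beta>. restrict (Poly_Mapping.lookup \<beta>) (Poly_Mapping.keys \<alpha>)"
  have le: "Poly_Mapping.lookup \<beta> k \<le> Poly_Mapping.lookup \<alpha> k" if "\<beta> \<in> ?B" for \<beta> k
    using that by (auto simp: lookup_add)
  have "?g ` ?B \<subseteq> (\<Pi>\<^sub>E k\<in>Poly_Mapping.keys \<alpha>. {..Poly_Mapping.lookup \<alpha> k})"
    using le by auto
  then have "finite (?g ` ?B)"
    by (rule finite_subset) (auto intro: finite_PiE)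
  moreover have "inj_on ?g ?B"
  proof (rule inj_onI, rule poly_mapping_eqI)
    fix \<beta> \<beta>' k
    assume *: "\<beta> \<in> ?B" "\<beta>' \<in> ?B" "?g \<beta> = ?g \<beta>'"
    show "Poly_Mapping.lookup \<beta> k = Poly_Mapping.lookup \<beta>' k"
    proof (cases "k \<in> Poly_Mapping.keys \<alpha>")
      case True
      then show ?thesis using fun_cong[OF *(3), of k] by simp
    next
      case False
      then show ?thesis using le[OF *(1), of k] le[OF *(2), of k] by (simp add: in_keys_iff)
    qed
  qed
  ultimately have "finite ?B" by (rule finite_imageD)
  moreover have "{(\<beta>, \<gamma>). \<beta> + \<gamma> = \<alpha>} \<subseteq> (\<lambda>\<beta>. (\<beta>, \<alpha> - \<beta>)) ` ?B"
    by auto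
  ultimately show ?thesis by (blast intro: finite_subset)
qed

definition power_sum :: "nat \<Rightarrow> series" where
  "power_sum k = (\<lambda>\<alpha>. if \<exists>i. \<alpha> = Poly_Mapping.single i k then 1 else 0)"

definition power_sum_partition :: "nat list \<Rightarrow> series" where
  "power_sum_partition \<nu> = foldr (\<lambda>k. series_mult (power_sum k)) \<nu> series_one"

definition tableau_monomial ::
    "nat list \<Rightarrow> nat list \<Rightarrow> (nat \<times> nat \<Rightarrow> nat) \<Rightarrow> (nat \<Rightarrow>\<^sub>0 nat)" where
  "tableau_monomial lam mu T = (\<Sum>b\<in>skew_diagram lam mu. Poly_Mapping.single (T b) 1)"

lemma finite_SSYT_monomial: "finite {T \<in> SSYT lam mu. tableau_monomial lam mu T = \<alpha>}"
proof (rule finite_subset)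
  let ?D = "skew_diagram lam mu"
  have "T b \<in> Poly_Mapping.keys (tableau_monomial lam mu T)" if "b \<in> ?D" for T b
  proof -
    have "1 \<le> (\<Sum>b'\<in>?D. Poly_Mapping.lookup (Poly_Mapping.single (T b') (1::nat)) (T b))"
      using member_le_sum[OF that, of "\<lambda>b'. Poly_Mapping.lookup (Poly_Mapping.single (T b') (1::nat)) (T b)"]
        finite_skew_diagram by simp
    then show ?thesis
      by (simp add: tableau_monomial_def in_keys_iff lookup_sum)
  qed
  then show "{T \<in> SSYT lam mu. tableau_monomial lam mu T = \<alpha>} \<subseteq> ?D \<rightarrow>\<^sub>E Poly_Mapping.keys \<alpha>"
    by (auto simp: SSYT_def PiE_def)
  show "finite (?D \<rightarrow>\<^sub>E Poly_Mapping.keys \<alpha>)"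
    by (intro finite_PiE finite_skew_diagram) simp
qed

definition skew_schur :: "nat list \<Rightarrow> nat list \<Rightarrow> series" where
  "skew_schur lam mu = (\<lambda>\<alpha>. of_nat (card {T \<in> SSYT lam mu. tableau_monomial lam mu T = \<alpha>}))"


section \<open>Skew characters\<close>

definition z :: "nat list \<Rightarrow> nat" where
  "z \<nu> = (\<Prod>j\<in>set \<nu>. fact (count_list \<nu> j) * j ^ count_list \<nu> j)"

text \<open>The power sums of the partitions of \<open>n\<close> are linearly independent, so the defining identity
  determines \<open>\<chi>\<close> on \<open>partitions_of n\<close>; the values elsewhere are irrelevant.\<close>

definition skew_char :: "nat list \<Rightarrow> nat list \<Rightarrow> nat list \<Rightarrow> complex" where
  "skew_char lam mu = (SOME \<chi>. skew_schur lam mu =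
     (\<lambda>\<alpha>. \<Sum>\<nu>\<in>partitions_of (card (skew_diagram lam mu)).
        \<chi> \<nu> * power_sum_partition \<nu> \<alpha> / of_nat (z \<nu>)))"

definition primitive_root_of_unity :: "nat \<Rightarrow> complex \<Rightarrow> bool" where
  "primitive_root_of_unity n \<xi> \<longleftrightarrow> \<xi> ^ n = 1 \<and> (\<forall>k. 0 < k \<and> k < n \<longrightarrow> \<xi> ^ k \<noteq> 1)"

end

theory Submission
  imports Defs "HOL-Combinatorics.Permutations" "HOL-Computational_Algebra.Polynomial_FPS"
    "HOL-Library.Product_Lexorder"
begin

text \<open>
  The idea is to substitute \<open>x\<^sub>i = q\<^bsup>i+1\<^esup>\<close> into the expansion of the skew Schur function in power sums
  and then to let \<open>q\<close> become a root of unity. Under the substitution a power sum \<open>p\<^sub>k\<close> becomes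
  \<open>q\<^sup>k / (1 - q\<^sup>k)\<close>. The skew Schur function becomes
  \<open>q\<^sup>n \<Sum>\<^sub>S q\<^bsup>comaj S\<^esup> / ((1 - q) (1 - q\<^sup>2) \<dots> (1 - q\<^sup>n))\<close>, where \<open>S\<close> runs over the standard tableaux and \<open>comaj S\<close> is the
  sum of \<open>n - j\<close> over the descents \<open>j\<close> of \<open>S\<close>; this holds because standardization splits a semistandard
  tableau into a standard tableau and a weakly increasing sequence that has to increase strictly at the
  descents (\<open>specialize_skew_schur_SYT\<close>). Comparing the two expressions gives, with
  \<open>n = d m\<close>,

  \<open>\<Sum>\<^sub>S q\<^bsup>comaj S\<^esup> = \<Sum>\<^sub>\<nu> \<chi>(\<nu>) / z\<^sub>\<nu> \<cdot> (1 - q) \<dots> (1 - q\<^sup>n) / \<Prod>\<^sub>i (1 - q\<^bsup>\<nu>\<^sub>i\<^esup>)\<close>.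

  At a primitive \<open>m\<close>-th root of unity the numerator vanishes to order \<open>d\<close>, and the denominator vanishes to
  order equal to the number of parts divisible by \<open>m\<close>. Since the parts sum to \<open>d m\<close>, that number reaches
  \<open>d\<close> only for \<open>\<nu> = (m\<^sup>d)\<close>, where the quotient takes the value \<open>d! m\<^sup>d = z\<^sub>\<nu>\<close>
  (\<open>has_value_at_term\<close>). So \<open>\<chi>((m\<^sup>d))\<close> is the value of \<open>\<Sum>\<^sub>S q\<^bsup>comaj S\<^esup>\<close> at every primitive
  \<open>m\<close>-th root of unity. As \<open>comaj S + maj S\<close> is a multiple of \<open>n\<close>, inverting the root turns \<open>comaj\<close> into
  \<open>maj\<close>.

  The coefficients \<open>\<chi>\<close> are introduced by a choice operator, so it must also be shown that the expansion
  in power sums exists. This takes two facts: skew Schur functions are symmetric, by the Bender-Knuth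
  involution (\<open>skew_schur_adjacent_transposition\<close>), and every symmetric series that is homogeneous of degree
  \<open>n\<close> is a linear combination of power sums (\<open>symmetric_series_power_sum_span\<close>).
\<close>

unbundle fps_syntax


section \<open>Symmetry of skew Schur functions\<close>

definition part :: "nat list \<Rightarrow> nat \<Rightarrow> nat" where
  "part lam r = (if r < length lam then lam ! r else 0)"

lemma diagram_part: "diagram lam = {(r, c). c < part lam r}"
  by (auto simp: diagram_def part_def split: if_splits)

lemma part_antimono:
  assumes "is_partition lam" "r \<le> r'"
  shows "part lam r' \<le> part lam r"
  using assms
  by (auto simp: is_partition_def part_def sorted_wrt_iff_nth_less le_less)

locale skew_tableaux =
  fixes lam mu :: "nat list"
  assumes shape: "skew_shape lam mu"
begin

abbreviation (input) "D \<equiv> skew_diagram lam mu"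

lemma skew_diagram_part: "(r, c) \<in> D \<longleftrightarrow> part mu r \<le> c \<and> c < part lam r"
  by (auto simp: skew_diagram_def diagram_part)

lemma part_mu_le_lam: "part mu r \<le> part lam r"
proof (rule ccontr)
  assume "\<not> ?thesis"
  then have "(r, part lam r) \<in> diagram mu" by (simp add: diagram_part)
  then have "(r, part lam r) \<in> diagram lam" using shape by (auto simp: skew_shape_def)
  then show False by (simp add: diagram_part)
qed

lemma skew_part_antimono:
  assumes "r \<le> r'"
  shows "part lam r' \<le> part lam r" "part mu r' \<le> part mu r"
  using shape assms part_antimono by (auto simp: skew_shape_def)

lemma skew_diagram_convex:
  assumes "(r, c) \<in> D" "(r', c') \<in> D" "r \<le> i" "i \<le> r'" "c \<le> j" "j \<le> c'"
  shows "(i, j) \<in> D"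
  using assms skew_part_antimono[of r i] skew_part_antimono[of i r']
  by (auto simp: skew_diagram_part)

lemma SSYT_row:
  assumes "T \<in> SSYT lam mu" "(r, c) \<in> D" "(r, c') \<in> D" "c \<le> c'"
  shows "T (r, c) \<le> T (r, c')"
  using assms by (cases "c = c'") (auto simp: SSYT_def)

lemma SSYT_col:
  assumes "T \<in> SSYT lam mu" "(r, c) \<in> D" "(r', c) \<in> D" "r < r'"
  shows "T (r, c) < T (r', c)"
  using assms by (auto simp: SSYT_def)

text \<open>The boxes of row \<open>r\<close> with entries less than \<open>k\<close> form an initial segment of that row, which ends just
  before column \<open>row_end T k r\<close>. For fixed \<open>k\<close> these numbers are the parts of the partition that bounds
  the sublevel set.\<close>
definition row_end :: "(nat \<times> nat \<Rightarrow> nat) \<Rightarrow> nat \<Rightarrow> nat \<Rightarrow> nat" where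
  "row_end T k r = part mu r + card {c. (r, c) \<in> D \<and> T (r, c) < k}"

lemma row_end_eqI:
  assumes "part mu r \<le> x" "x \<le> part lam r"
    and "\<And>c. (r, c) \<in> D \<Longrightarrow> T (r, c) < k \<longleftrightarrow> c < x"
  shows "row_end T k r = x"
proof -
  have "{c. (r, c) \<in> D \<and> T (r, c) < k} = {part mu r..<x}"
    using assms by (auto simp: skew_diagram_part)
  then show ?thesis using assms by (simp add: row_end_def)
qed

lemma row_end:
  assumes T: "T \<in> SSYT lam mu"
  shows "part mu r \<le> row_end T k r" "row_end T k r \<le> part lam r"
    and less_row_end_iff: "(r, c) \<in> D \<Longrightarrow> c < row_end T k r \<longleftrightarrow> T (r, c) < k"
proof -
  define x where "x = Min (insert (part lam r) {c. (r, c) \<in> D \<and> \<not> T (r, c) < k})"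
  have fin: "finite {c. (r, c) \<in> D \<and> P c}" for P
    by (rule finite_subset[of _ "{..part lam r}"]) (auto simp: skew_diagram_part)
  have mem: "x = part lam r \<or> (r, x) \<in> D \<and> \<not> T (r, x) < k"
    using Min_in[of "insert (part lam r) {c. (r, c) \<in> D \<and> \<not> T (r, c) < k}"] fin
    by (auto simp: x_def)
  have le: "x \<le> part lam r" using fin by (simp add: x_def)
  have ge: "part mu r \<le> x" using mem part_mu_le_lam[of r] by (auto simp: skew_diagram_part)
  have iff: "T (r, c) < k \<longleftrightarrow> c < x" if "(r, c) \<in> D" for c
  proof
    assume "T (r, c) < k"
    show "c < x"
    proof (rule ccontr)
      assume "\<not> c < x"
      then have "(r, x) \<in> D \<and> \<not> T (r, x) < k" using mem that by (auto simp: skew_diagram_part)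
      then show False using SSYT_row[OF T, of r x c] that \<open>\<not> c < x\<close> \<open>T (r, c) < k\<close> by simp
    qed
  next
    assume "c < x"
    then show "T (r, c) < k" using fin that by (auto simp: x_def)
  qed
  have "row_end T k r = x" by (rule row_end_eqI) (use ge le iff in auto)
  then show "part mu r \<le> row_end T k r" "row_end T k r \<le> part lam r"
    "(r, c) \<in> D \<Longrightarrow> c < row_end T k r \<longleftrightarrow> T (r, c) < k" using ge le iff by auto
qed

lemma row_end_mono:
  assumes "k \<le> k'"
  shows "row_end T k r \<le> row_end T k' r"
proof -
  have "finite {c. (r, c) \<in> D \<and> T (r, c) < k'}"
    by (rule finite_subset[of _ "{..part lam r}"]) (auto simp: skew_diagram_part)
  then show ?thesis using assms by (auto simp: row_end_def intro!: card_mono)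
qed

text \<open>The entry above an entry less than \<open>k + 1\<close> is less than \<open>k\<close>: successive sublevel sets of a
  semistandard tableau differ by a horizontal strip.\<close>
lemma row_end_interlace:
  assumes T: "T \<in> SSYT lam mu"
  shows "row_end T (Suc k) (Suc r) \<le> row_end T k r"
proof (rule ccontr)
  let ?c = "row_end T (Suc k) (Suc r) - 1"
  assume *: "\<not> ?thesis"
  have "(Suc r, ?c) \<in> D" and cge: "part mu r \<le> ?c"
    using * row_end(1,2)[OF T, where r="Suc r" and k="Suc k"]
      row_end(1)[OF T, where r=r and k=k] skew_part_antimono[of r "Suc r"]
    by (auto simp: skew_diagram_part)
  then have D': "(r, ?c) \<in> D"
    using skew_part_antimono[of r "Suc r"] by (auto simp: skew_diagram_part)
  have "T (Suc r, ?c) < Suc k"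
    using less_row_end_iff[OF T \<open>(Suc r, ?c) \<in> D\<close>, of "Suc k"] * by simp
  then have "T (r, ?c) < k" using SSYT_col[OF T D' \<open>(Suc r, ?c) \<in> D\<close>] by simp
  then have "?c < row_end T k r" using less_row_end_iff[OF T D'] by simp
  then show False using * by simp
qed

text \<open>If all entries other than \<open>i\<close> and \<open>i + 1\<close> are kept, then column strictness confines the column at
  which row \<open>r\<close> switches from \<open>i\<close> to \<open>i + 1\<close> to an interval. Its lower end is
  \<open>max (row_end T i r) (row_end T (i + 2) (r + 1))\<close>: an \<open>i + 1\<close>
  must not stand above an entry that is at most \<open>i + 1\<close>.
  Its upper end is bounded in the same way by the row above. The Bender-Knuth involution reflects the switching
  point in this interval, independently in each row.\<close>
definition flip_end :: "nat \<Rightarrow> (nat \<times> nat \<Rightarrow> nat) \<Rightarrow> nat \<Rightarrow> nat" where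
  "flip_end i T r = max (row_end T i r) (row_end T (i + 2) (Suc r)) +
     (if r = 0 then row_end T (i + 2) r else min (row_end T (i + 2) r) (row_end T i (r - 1))) -
     row_end T (i + 1) r"

definition bender_knuth :: "nat \<Rightarrow> (nat \<times> nat \<Rightarrow> nat) \<Rightarrow> (nat \<times> nat \<Rightarrow> nat)" where
  "bender_knuth i T = restrict (\<lambda>(r, c). if T (r, c) \<in> {i, i + 1}
     then (if c < flip_end i T r then i else i + 1) else T (r, c)) D"

lemma flip_end_bounds:
  assumes T: "T \<in> SSYT lam mu"
  shows "row_end T i r \<le> flip_end i T r" "row_end T (i + 2) (Suc r) \<le> flip_end i T r"
    "flip_end i T r \<le> row_end T (i + 2) r" "flip_end i T (Suc r) \<le> row_end T i r"
proof -
  have 1: "row_end T (i + 1) s \<le> row_end T (i + 2) s" "row_end T i s \<le> row_end T (i + 1) s" for s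
    by (auto intro: row_end_mono)
  have 2: "row_end T (i + 2) (Suc s) \<le> row_end T (i + 1) s"
    "row_end T (i + 1) (Suc s) \<le> row_end T i s" for s
    using row_end_interlace[OF T, of "i + 1" s] row_end_interlace[OF T, of "i" s] by auto
  have 3: "s \<noteq> 0 \<Longrightarrow> row_end T (i + 1) s \<le> row_end T i (s - 1)" for s
    using 2(2)[of "s - 1"] by simp
  show "row_end T i r \<le> flip_end i T r" "row_end T (i + 2) (Suc r) \<le> flip_end i T r"
    "flip_end i T r \<le> row_end T (i + 2) r" "flip_end i T (Suc r) \<le> row_end T i r"
    using 1[of r] 2[of r] 3[of r] 1[of "Suc r"] 2[of "Suc r"] unfolding flip_end_def
    by (auto simp: max_def min_def)
qed

text \<open>A filling is determined by its sublevel sets, and \<open>bender_knuth i\<close> changes only the one below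
  \<open>i + 1\<close>. All properties of the involution are read off from this description.\<close>
lemma bender_knuth_less_iff:
  assumes T: "T \<in> SSYT lam mu" and rc: "(r, c) \<in> D"
  shows "bender_knuth i T (r, c) < k \<longleftrightarrow> 
     c < (if k = i + 1 then flip_end i T r else row_end T k r)"
proof -
  note [simp] = less_row_end_iff[OF T rc]
  have "c < row_end T i r \<Longrightarrow> c < flip_end i T r" "c < flip_end i T r \<Longrightarrow> c < row_end T (i+2) r"
    using flip_end_bounds[OF T, where i=i and r=r] by linarith+
  then have "T (r, c) < i \<Longrightarrow> c < flip_end i T r" "c < flip_end i T r \<Longrightarrow> T (r, c) < i + 2"
    by simp_all
  then show ?thesis
    using rc by (auto simp: bender_knuth_def)
qed

lemma bender_knuth_SSYT:
  assumes T: "T \<in> SSYT lam mu"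
  shows "bender_knuth i T \<in> SSYT lam mu"
proof -
  let ?U = "bender_knuth i T"
  let ?e = "\<lambda>k r. if k = i + 1 then flip_end i T r else row_end T k r"
  have inter: "?e (Suc k) (Suc r) \<le> ?e k r" for k r
    using row_end_interlace[OF T, of k r] flip_end_bounds[OF T, where i=i and r=r]
    by (auto simp: numeral_2_eq_2)
  have row: "?U (r, c) \<le> ?U (r, c')" if "(r, c) \<in> D" "(r, c') \<in> D" "c < c'" for r c c'
    using bender_knuth_less_iff[OF T that(1), of i "Suc (?U (r, c'))"] 
      bender_knuth_less_iff[OF T that(2), of i "Suc (?U (r, c'))"] that(3)
    by auto
  have col1: "?U (r, c) < ?U (Suc r, c)" if "(r, c) \<in> D" "(Suc r, c) \<in> D" for r c
  proof -
    have "c < ?e (Suc (?U (Suc r, c))) (Suc r)"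
      using bender_knuth_less_iff[OF T that(2), of i "Suc (?U (Suc r, c))"] by simp
    also note inter
    finally show ?thesis
      using bender_knuth_less_iff[OF T that(1), of i "?U (Suc r, c)"] by simp
  qed
  have col: "?U (r, c) < ?U (r', c)" if D: "(r, c) \<in> D" "(r', c) \<in> D" and "r < r'" for r r' c
    using \<open>r < r'\<close> D
  proof (induction rule: strict_inc_induct)
    case (base r)
    then show ?case using col1 by blast
  next
    case (step r)
    have "(Suc r, c) \<in> D"
      using skew_diagram_convex[of r c r' c "Suc r" c] step.hyps step.prems by simp
    then have "?U (r, c) < ?U (Suc r, c)" "?U (Suc r, c) < ?U (r', c)"
      using col1 step.IH step.prems by blast+
    then show ?case by (rule less_trans)
  qed
  have "?U \<in> extensional D" by (simp add: bender_knuth_def)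
  then show ?thesis using row col by (simp add: SSYT_def)
qed

lemma row_end_bender_knuth:
  assumes T: "T \<in> SSYT lam mu"
  shows "row_end (bender_knuth i T) k r = (if k = i + 1 then flip_end i T r else row_end T k r)"
  using bender_knuth_less_iff[OF T] flip_end_bounds(1,3)[OF T, where i=i and r=r]
    row_end(1)[OF T, where k=i and r=r] row_end(2)[OF T, where k="i+2" and r=r]
    row_end(1,2)[OF T, where k=k and r=r]
  by (intro row_end_eqI) (auto split: if_splits)

text \<open>The truncated subtraction in \<open>flip_end\<close> is harmless, because the original switching point does not
  exceed the upper end of the interval.\<close>
lemma flip_end_sum:
  assumes T: "T \<in> SSYT lam mu"
  shows "flip_end i T r + row_end T (i + 1) r = max (row_end T i r) (row_end T (i + 2) (Suc r)) +
     (if r = 0 then row_end T (i + 2) r else min (row_end T (i + 2) r) (row_end T i (r - 1)))"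
proof -
  have "row_end T (i + 1) r \<le> row_end T (i + 2) r" by (auto intro: row_end_mono)
  moreover have "r \<noteq> 0 \<Longrightarrow> row_end T (i + 1) r \<le> row_end T i (r - 1)"
    using row_end_interlace[OF T, of i "r - 1"] by simp
  ultimately show ?thesis by (auto simp: flip_end_def)
qed

lemma bender_knuth_involution:
  assumes T: "T \<in> SSYT lam mu"
  shows "bender_knuth i (bender_knuth i T) = T"
proof (rule ext)
  fix b
  note U = bender_knuth_SSYT[OF T, of i]
  have flip: "flip_end i (bender_knuth i T) r = row_end T (i + 1) r" for r
    using flip_end_sum[OF U, of i r] flip_end_sum[OF T, of i r]
    by (cases "r = 0") (simp_all add: row_end_bender_knuth[OF T])
  show "bender_knuth i (bender_knuth i T) b = T b"
  proof (cases "b \<in> D")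
    case True
    then obtain r c where b: "b = (r, c)" "(r, c) \<in> D" by (cases b) auto
    have "bender_knuth i (bender_knuth i T) (r, c) < k \<longleftrightarrow> T (r, c) < k" for k
      using bender_knuth_less_iff[OF U b(2), of i k] less_row_end_iff[OF T b(2), of k]
      by (auto simp: flip row_end_bender_knuth[OF T])
    then show ?thesis using b by (metis less_irrefl linorder_neqE_nat)
  next
    case False
    then have "T b = undefined" using T by (intro extensional_arb[of T D]) (auto simp: SSYT_def)
    then show ?thesis using False by (simp add: bender_knuth_def)
  qed
qed

lemma lookup_tableau_monomial:
  "Poly_Mapping.lookup (tableau_monomial lam mu T) k = card {b \<in> D. T b = k}"
  by (simp add: tableau_monomial_def lookup_sum lookup_single when_def finite_skew_diagram
      sum.If_cases Int_def)

lemma lookup_tableau_monomial_row_end: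
  assumes T: "T \<in> SSYT lam mu"
  shows "Poly_Mapping.lookup (tableau_monomial lam mu T) k =
    (\<Sum>r<length lam. row_end T (Suc k) r - row_end T k r)"
proof -
  have "{b \<in> D. T b = k} = (SIGMA r:{..<length lam}. {row_end T k r..<row_end T (Suc k) r})"
  proof (intro set_eqI)
    fix b :: "nat \<times> nat"
    obtain r c where b: "b = (r, c)" by (cases b) auto
    have "(r, c) \<in> D" if "c \<in> {row_end T k r..<row_end T (Suc k) r}"
      using that row_end(1)[OF T, of r k] row_end(2)[OF T, of "Suc k" r]
      by (auto simp: skew_diagram_part)
    moreover have "r < length lam" if "(r, c) \<in> D"
      using that by (auto simp: skew_diagram_part part_def split: if_splits)
    moreover have "T (r, c) = k \<longleftrightarrow> c \<in> {row_end T k r..<row_end T (Suc k) r}" if "(r, c) \<in> D"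
      using less_row_end_iff[OF T that, of k] less_row_end_iff[OF T that, of "Suc k"] by auto
    ultimately show "b \<in> {b \<in> D. T b = k} \<longleftrightarrow> 
        b \<in> (SIGMA r:{..<length lam}. {row_end T k r..<row_end T (Suc k) r})"
      unfolding b mem_Sigma_iff mem_Collect_eq lessThan_iff by blast
  qed
  then show ?thesis by (simp add: lookup_tableau_monomial)
qed

text \<open>Every row contributes its lower and its upper bound, and the lower bound of one row pairs with the
  upper bound of the next: \<open>max x y + min x y = x + y\<close>.\<close>
lemma sum_max_min_telescope:
  fixes a b :: "nat \<Rightarrow> nat"
  defines "m \<equiv> \<lambda>r. if r = 0 then b r else min (b r) (a (r - 1))"
  shows "(\<Sum>r<N. max (a r) (b (Suc r)) + m r) + m N = (\<Sum>r<N. a r + b r) + b N"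
  by (induction N) (auto simp: m_def max_def min_def)

text \<open>Summed over all rows, the interval ends add up to the sizes of the two sublevel sets below \<open>i\<close> and
  below \<open>i + 2\<close>. Hence the reflection exchanges the number of entries \<open>i\<close> with that of entries \<open>i + 1\<close>.\<close>
lemma sum_flip_end:
  assumes T: "T \<in> SSYT lam mu"
  shows "(\<Sum>r<length lam. flip_end i T r) + (\<Sum>r<length lam. row_end T (i + 1) r) =
    (\<Sum>r<length lam. row_end T i r) + (\<Sum>r<length lam. row_end T (i + 2) r)"
proof -
  have "row_end T (i + 2) (length lam) = 0"
    using row_end(2)[OF T, of "i + 2" "length lam"] by (simp add: part_def)
  then show ?thesis
    using sum_max_min_telescope[where N = "length lam" and a = "row_end T i" and b = "row_end T (i + 2)"]
    unfolding sum.distrib[symmetric] flip_end_sum[OF T] by (simp split: if_splits)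
qed

lemma tableau_monomial_bender_knuth:
  assumes T: "T \<in> SSYT lam mu"
  shows "tableau_monomial lam mu (bender_knuth i T) =
    Poly_Mapping.map_key (transpose i (Suc i)) (tableau_monomial lam mu T)"
proof (rule poly_mapping_eqI)
  fix k
  note U = bender_knuth_SSYT[OF T, of i]
  have le: "row_end T k r \<le> row_end T (Suc k) r" for k r by (auto intro: row_end_mono)
  have fl: "row_end T i r \<le> flip_end i T r" "flip_end i T r \<le> row_end T (i + 2) r" for r
    using flip_end_bounds[OF T] by auto
  note sums = sum_flip_end[OF T, of i]
  have lo: "(\<Sum>r<length lam. flip_end i T r - row_end T i r) =
      (\<Sum>r<length lam. row_end T (i + 2) r - row_end T (i + 1) r)"
    using sums fl(1) le[of "i + 1"] by (simp add: sum_subtractf_nat)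
  have hi: "(\<Sum>r<length lam. row_end T (i + 2) r - flip_end i T r) =
      (\<Sum>r<length lam. row_end T (i + 1) r - row_end T i r)"
    using sums fl(2) le[of i] by (simp add: sum_subtractf_nat)
  \<comment> \<open>These two sums count the entries \<open>i\<close> and \<open>i + 1\<close> after the flip.\<close>
  consider "k = i" | "k = Suc i" | "k \<noteq> i" "k \<noteq> Suc i" by blast
  then have "(\<Sum>r<length lam. row_end (bender_knuth i T) (Suc k) r - row_end (bender_knuth i T) k r) =
      (\<Sum>r<length lam. row_end T (Suc (transpose i (Suc i) k)) r - row_end T (transpose i (Suc i) k) r)"
    using lo hi by cases (simp_all add: row_end_bender_knuth[OF T])
  then show "Poly_Mapping.lookup (tableau_monomial lam mu (bender_knuth i T)) k =
      Poly_Mapping.lookup (Poly_Mapping.map_key (transpose i (Suc i)) (tableau_monomial lam mu T)) k"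
    by (simp add: Poly_Mapping.map_key.rep_eq lookup_tableau_monomial_row_end T U)
qed

lemma skew_schur_adjacent_transposition:
  "skew_schur lam mu (Poly_Mapping.map_key (transpose i (Suc i)) \<alpha>) = skew_schur lam mu \<alpha>"
proof -
  let ?s = "Poly_Mapping.map_key (transpose i (Suc i)) :: (nat \<Rightarrow>\<^sub>0 nat) \<Rightarrow> _"
  let ?A = "\<lambda>\<alpha>. {T \<in> SSYT lam mu. tableau_monomial lam mu T = \<alpha>}"
  have s: "?s (?s \<beta>) = \<beta>" for \<beta>
    by (rule poly_mapping_eqI) (simp add: Poly_Mapping.map_key.rep_eq)
  have "bij_betw (bender_knuth i) (?A \<alpha>) (?A (?s \<alpha>))"
    by (rule bij_betwI[where g = "bender_knuth i"])
      (auto simp: bender_knuth_SSYT bender_knuth_involution tableau_monomial_bender_knuth s)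
  then show ?thesis by (simp add: skew_schur_def bij_betw_same_card)
qed

end

section \<open>Symmetric series and power sums\<close>

definition symmetric_series :: "series \<Rightarrow> bool" where
  "symmetric_series F \<longleftrightarrow>
     (\<forall>p S \<alpha>. finite S \<longrightarrow> p permutes S \<longrightarrow> F (Poly_Mapping.map_key p \<alpha>) = F \<alpha>)"

text \<open>Adjacent transpositions generate all finitary permutations.\<close>
lemma symmetric_seriesI_adjacent:
  assumes adj: "\<And>i \<alpha>. F (Poly_Mapping.map_key (transpose i (Suc i)) \<alpha>) = F \<alpha>"
  shows "symmetric_series F"
proof -
  have less: "\<forall>\<alpha>. F (Poly_Mapping.map_key (transpose i (i + Suc k)) \<alpha>) = F \<alpha>" for i k
  proof (induction k)
    case 0
    then show ?case using adj by simp
  next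
    case (Suc k)
    let ?j = "i + Suc k"
    have t: "transpose i (Suc ?j) = transpose ?j (Suc ?j) \<circ> transpose i ?j \<circ> transpose ?j (Suc ?j)"
      using transpose_comp_triple[of "Suc ?j" i ?j] by (simp add: transpose_commute)
    have "F (Poly_Mapping.map_key (transpose i (Suc ?j)) \<alpha>) = F \<alpha>" for \<alpha>
      unfolding t using Suc.IH
      by (simp add: Poly_Mapping.map_key_compose[symmetric] inj_compose adj del: add_Suc_right)
    then show ?case by simp
  qed
  have transp: "F (Poly_Mapping.map_key (transpose a b) \<alpha>) = F \<alpha>" for a b \<alpha>
  proof -
    consider "a = b" | k where "b = a + Suc k" | k where "a = b + Suc k"
      by (metis add_Suc_right less_iff_Suc_add linorder_neqE_nat)
    then show ?thesis
      using less[of a] less[of b] map_key_id[of \<alpha>]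
      by cases (auto simp: transpose_commute[of "Suc (b + _)" b] id_def)
  qed
  have "\<forall>\<alpha>. F (Poly_Mapping.map_key p \<alpha>) = F \<alpha>" if "p permutes S" "finite S" for p S
    using that
  proof (induction rule: permutes_induct)
    case id
    show ?case by (simp add: id_def map_key_id)
  next
    case (swap a b p)
    have "Poly_Mapping.map_key (transpose a b \<circ> p) \<alpha> =
        Poly_Mapping.map_key p (Poly_Mapping.map_key (transpose a b) \<alpha>)" for \<alpha> :: "nat \<Rightarrow>\<^sub>0 nat"
      using swap by (intro Poly_Mapping.map_key_compose[symmetric]) (auto simp: permutes_inj)
    then show ?case using swap transp by metis
  qed
  then show ?thesis by (auto simp: symmetric_series_def)
qed

definition exponents :: "(nat \<Rightarrow>\<^sub>0 nat) \<Rightarrow> nat multiset" where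
  "exponents \<alpha> = image_mset (Poly_Mapping.lookup \<alpha>) (mset_set (Poly_Mapping.keys \<alpha>))"

text \<open>Two monomials with the same multiset of exponents are related by a permutation of the finitely many
  variables that occur in either of them.\<close>
lemma symmetric_series_exponents:
  assumes F: "symmetric_series F" and eq: "exponents \<alpha> = exponents \<beta>"
  shows "F \<alpha> = F \<beta>"
proof -
  let ?K = "Poly_Mapping.keys \<alpha> \<union> Poly_Mapping.keys \<beta>"
  have ext: "image_mset (Poly_Mapping.lookup \<gamma>) (mset_set ?K) =
      exponents \<gamma> + replicate_mset (card ?K - size (exponents \<gamma>)) 0"
    if "Poly_Mapping.keys \<gamma> \<subseteq> ?K" for \<gamma> :: "nat \<Rightarrow>\<^sub>0 nat"
  proof -
    have "mset_set ?K = mset_set (Poly_Mapping.keys \<gamma>) + mset_set (?K - Poly_Mapping.keys \<gamma>)"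
      using mset_set_Union[of "Poly_Mapping.keys \<gamma>" "?K - Poly_Mapping.keys \<gamma>"] that
      by (simp add: Un_absorb1 del: Un_Diff_cancel2)
    moreover have "image_mset (Poly_Mapping.lookup \<gamma>) (mset_set (?K - Poly_Mapping.keys \<gamma>)) =
        image_mset (\<lambda>_. 0) (mset_set (?K - Poly_Mapping.keys \<gamma>))"
      by (intro image_mset_cong) (auto simp: in_keys_iff)
    moreover have "card (?K - Poly_Mapping.keys \<gamma>) = card ?K - size (exponents \<gamma>)"
      using that by (simp add: card_Diff_subset exponents_def)
    ultimately show ?thesis by (simp add: exponents_def image_mset_const_eq)
  qed
  have "image_mset (Poly_Mapping.lookup \<alpha>) (mset_set ?K) = image_mset (Poly_Mapping.lookup \<beta>) (mset_set ?K)"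
    using ext[of \<alpha>] ext[of \<beta>] eq by simp
  then obtain p where p: "p permutes ?K"
    "\<forall>x\<in>?K. Poly_Mapping.lookup \<alpha> x = Poly_Mapping.lookup \<beta> (p x)"
    using image_mset_eq_implies_permutes[of ?K "Poly_Mapping.lookup \<alpha>" "Poly_Mapping.lookup \<beta>"] by auto
  have "Poly_Mapping.lookup \<alpha> x = Poly_Mapping.lookup \<beta> (p x)" for x
  proof (cases "x \<in> ?K")
    case False
    then show ?thesis using permutes_not_in[OF p(1) False] by (auto simp: in_keys_iff)
  qed (use p in blast)
  then have "\<alpha> = Poly_Mapping.map_key p \<beta>"
    using p(1) by (intro poly_mapping_eqI) (simp add: Poly_Mapping.map_key.rep_eq permutes_inj)
  then show ?thesis using F p(1) unfolding symmetric_series_def by (metis finite_Un finite_keys)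
qed

definition monomial_of :: "nat list \<Rightarrow> nat list \<Rightarrow> (nat \<Rightarrow>\<^sub>0 nat)" where
  "monomial_of is xs = (\<Sum>j<length xs. Poly_Mapping.single (is ! j) (xs ! j))"

definition placements :: "nat list \<Rightarrow> (nat \<Rightarrow>\<^sub>0 nat) \<Rightarrow> nat list set" where
  "placements xs \<alpha> = {is. length is = length xs \<and> distinct is \<and> monomial_of is xs = \<alpha>}"

text \<open>This is the sum of \<open>x\<^bsub>i\<^sub>1\<^esub>\<^bsup>a\<^sub>1\<^esup> \<dots> x\<^bsub>i\<^sub>l\<^esub>\<^bsup>a\<^sub>l\<^esup>\<close> over all lists of distinct indices: a
  monomial symmetric function, multiplied by the factorials of the multiplicities in \<open>xs\<close>. With this
  normalization the product rule below has no combinatorial factors.\<close>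
definition augmented_monomial :: "nat list \<Rightarrow> series" where
  "augmented_monomial xs = (\<lambda>\<alpha>. of_nat (card (placements xs \<alpha>)))"

lemma lookup_monomial_of:
  assumes "length is = length xs" "distinct is"
  shows "j < length xs \<Longrightarrow> Poly_Mapping.lookup (monomial_of is xs) (is ! j) = xs ! j"
    and "k \<notin> set is \<Longrightarrow> Poly_Mapping.lookup (monomial_of is xs) k = 0"
proof -
  assume j: "j < length xs"
  have "Poly_Mapping.lookup (monomial_of is xs) (is ! j) = (\<Sum>l<length xs. if l = j then xs ! l else 0)"
    unfolding monomial_of_def lookup_sum using assms j
    by (intro sum.cong) (auto simp: lookup_single when_def nth_eq_iff_index_eq)
  then show "Poly_Mapping.lookup (monomial_of is xs) (is ! j) = xs ! j" using j by simp
next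
  assume "k \<notin> set is"
  then show "Poly_Mapping.lookup (monomial_of is xs) k = 0"
    unfolding monomial_of_def lookup_sum using assms
    by (intro sum.neutral) (auto simp: lookup_single when_def)
qed

lemma placements_exponents:
  assumes "is \<in> placements xs \<alpha>" "0 \<notin> set xs"
  shows "set is = Poly_Mapping.keys \<alpha>" "exponents \<alpha> = mset xs"
proof -
  have len: "length is = length xs" and dis: "distinct is" and \<alpha>: "\<alpha> = monomial_of is xs"
    using assms by (auto simp: placements_def)
  note l = lookup_monomial_of[OF len dis]
  show keys: "set is = Poly_Mapping.keys \<alpha>"
  proof (intro set_eqI iffI)
    fix x assume "x \<in> set is"
    then obtain j where j: "j < length xs" "x = is ! j" using len by (auto simp: in_set_conv_nth)
    then have "xs ! j \<noteq> 0" using assms(2) by (metis nth_mem)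
    then show "x \<in> Poly_Mapping.keys \<alpha>" using l(1)[OF j(1)] j by (simp add: \<alpha> in_keys_iff)
  next
    fix x assume "x \<in> Poly_Mapping.keys \<alpha>"
    then show "x \<in> set is" using l(2)[of x] by (auto simp: \<alpha> in_keys_iff)
  qed
  have "map (Poly_Mapping.lookup \<alpha>) is = xs"
    using l(1) len unfolding \<alpha> by (auto intro: nth_equalityI)
  then show "exponents \<alpha> = mset xs"
    using dis by (auto simp: exponents_def keys[symmetric] mset_set_set simp flip: mset_map)
qed

lemma finite_placements:
  assumes "0 \<notin> set xs"
  shows "finite (placements xs \<alpha>)"
proof (rule finite_subset)
  show "placements xs \<alpha> \<subseteq> {is. set is \<subseteq> Poly_Mapping.keys \<alpha> \<and> length is = length xs}"
    using placements_exponents(1)[OF _ assms] by (auto simp: placements_def)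
qed (simp add: finite_lists_length_eq)

lemma map_key_monomial_of:
  assumes "bij p" "length is = length xs"
  shows "Poly_Mapping.map_key p (monomial_of is xs) = monomial_of (map (inv p) is) xs"
proof (rule poly_mapping_eqI)
  fix k
  have "is ! j = p k \<longleftrightarrow> inv p (is ! j) = k" for j
    using bij_inv_eq_iff[OF assms(1), of k "is ! j"] by metis
  then show "Poly_Mapping.lookup (Poly_Mapping.map_key p (monomial_of is xs)) k =
      Poly_Mapping.lookup (monomial_of (map (inv p) is) xs) k"
    using assms by (simp add: Poly_Mapping.map_key.rep_eq bij_is_inj monomial_of_def lookup_sum lookup_single)
qed

lemma symmetric_augmented_monomial: "symmetric_series (augmented_monomial xs)"
  unfolding symmetric_series_def
proof (intro allI impI)
  fix p S and \<alpha> :: "nat \<Rightarrow>\<^sub>0 nat" assume "finite (S :: nat set)" "p permutes S"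
  then have p: "bij p" by (simp add: permutes_bij)
  have inv: "Poly_Mapping.map_key (inv p) (Poly_Mapping.map_key p \<alpha>) = \<alpha>" 
    using p by (intro poly_mapping_eqI) 
      (simp add: Poly_Mapping.map_key.rep_eq bij_is_inj bij_imp_bij_inv bij_is_surj surj_f_inv_f)
  have 1: "monomial_of (map (inv p) is) xs = Poly_Mapping.map_key p \<alpha>"
    if "monomial_of is xs = \<alpha>" "length is = length xs" for "is"
    using map_key_monomial_of[OF p that(2)] that by simp
  have 2: "monomial_of (map p is) xs = \<alpha>"
    if "monomial_of is xs = Poly_Mapping.map_key p \<alpha>" "length is = length xs" for "is"
    using map_key_monomial_of[OF bij_imp_bij_inv[OF p] that(2)] that p inv by (simp add: inv_inv_eq)
  have inj: "inj_on p A" "inj_on (inv p) A" for A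
    using p bij_imp_bij_inv[OF p] by (auto simp: bij_def intro: inj_on_subset)
  have cancel: "map p (map (inv p) is) = is" "map (inv p) (map p is) = is" for "is"
    using p by (simp_all add: comp_def bij_is_inj bij_is_surj surj_f_inv_f)
  have "bij_betw (map (inv p)) (placements xs \<alpha>) (placements xs (Poly_Mapping.map_key p \<alpha>))"
    by (rule bij_betwI[where g = "map p"])
      (auto simp only: placements_def distinct_map inj 1 2 cancel mem_Collect_eq length_map)
  then show "augmented_monomial xs (Poly_Mapping.map_key p \<alpha>) = augmented_monomial xs \<alpha>"
    by (simp add: augmented_monomial_def bij_betw_same_card)
qed

lemma series_mult_assoc:
  "series_mult F (series_mult G H) \<alpha> = (\<Sum>(\<beta>, \<gamma>, \<delta>) | \<beta> + \<gamma> + \<delta> = \<alpha>. F \<beta> * G \<gamma> * H \<delta>)"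
proof -
  have "series_mult F (series_mult G H) \<alpha> =
      (\<Sum>p \<in> {(\<beta>, \<epsilon>). \<beta> + \<epsilon> = \<alpha>}. \<Sum>q \<in> {(\<gamma>, \<delta>). \<gamma> + \<delta> = snd p}. F (fst p) * G (fst q) * H (snd q))"
    by (simp add: series_mult_def sum_distrib_left case_prod_beta mult.assoc)
  also have "\<dots> = (\<Sum>(p, q) \<in> (SIGMA p:{(\<beta>, \<epsilon>). \<beta> + \<epsilon> = \<alpha>}. {(\<gamma>, \<delta>). \<gamma> + \<delta> = snd p}).
      F (fst p) * G (fst q) * H (snd q))"
    using finite_splittings by (subst sum.Sigma) auto
  also have "\<dots> = (\<Sum>(\<beta>, \<gamma>, \<delta>) | \<beta> + \<gamma> + \<delta> = \<alpha>. F \<beta> * G \<gamma> * H \<delta>)"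
    by (rule sum.reindex_bij_witness[where i = "\<lambda>(\<beta>, \<gamma>, \<delta>). ((\<beta>, \<gamma> + \<delta>), (\<gamma>, \<delta>))"
          and j = "\<lambda>(p, q). (fst p, fst q, snd q)"]) (auto simp: add.assoc)
  finally show ?thesis .
qed

text \<open>Only the products by power sums have to be permuted, and for these left-commutativity suffices.\<close>
lemma series_mult_left_commute: "series_mult F (series_mult G H) = series_mult G (series_mult F H)"
proof
  fix \<alpha>
  show "series_mult F (series_mult G H) \<alpha> = series_mult G (series_mult F H) \<alpha>"
    unfolding series_mult_assoc
    by (rule sum.reindex_bij_witness[where i = "\<lambda>(\<beta>, \<gamma>, \<delta>). (\<gamma>, \<beta>, \<delta>)"
          and j = "\<lambda>(\<beta>, \<gamma>, \<delta>). (\<gamma>, \<beta>, \<delta>)"]) (auto simp: add.commute mult.commute)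
qed

lemma power_sum_partition_mset:
  assumes "mset xs = mset ys"
  shows "power_sum_partition xs = power_sum_partition ys"
proof -
  have "fold (\<lambda>k. series_mult (power_sum k)) (rev xs) = fold (\<lambda>k. series_mult (power_sum k)) (rev ys)"
    using assms by (intro fold_multiset_equiv) (auto simp: fun_eq_iff series_mult_left_commute)
  then show ?thesis by (simp add: power_sum_partition_def foldr_conv_fold)
qed

lemma series_mult_power_sum:
  assumes "b > 0"
  shows "series_mult (power_sum b) F \<alpha> =
    (\<Sum>i | \<exists>\<gamma>. Poly_Mapping.single i b + \<gamma> = \<alpha>. F (\<alpha> - Poly_Mapping.single i b))"
proof -
  have inj: "Poly_Mapping.single i b = Poly_Mapping.single j b \<longleftrightarrow> i = j" for i j :: nat
    using assms by (metis lookup_single_eq lookup_single_not_eq less_irrefl)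
  have "series_mult (power_sum b) F \<alpha> =
      (\<Sum>(\<beta>, \<gamma>) | \<beta> + \<gamma> = \<alpha> \<and> (\<exists>i. \<beta> = Poly_Mapping.single i b). F \<gamma>)"
    unfolding series_mult_def using finite_splittings[of \<alpha>]
    by (intro sum.mono_neutral_cong_right) (auto simp: power_sum_def split: if_splits)
  also have "\<dots> = (\<Sum>i | \<exists>\<gamma>. Poly_Mapping.single i b + \<gamma> = \<alpha>. F (\<alpha> - Poly_Mapping.single i b))"
    by (rule sum.reindex_bij_witness[where j = "\<lambda>(\<beta>, \<gamma>). THE i. \<beta> = Poly_Mapping.single i b"
          and i = "\<lambda>i. (Poly_Mapping.single i b, \<alpha> - Poly_Mapping.single i b)"]) (auto simp: inj)
  finally show ?thesis .
qed

lemma finite_single_splittings: "finite {i. \<exists>\<gamma>. Poly_Mapping.single i b + \<gamma> = (\<alpha> :: nat \<Rightarrow>\<^sub>0 nat)}"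
  if "b > 0"
proof (rule finite_subset)
  show "{i. \<exists>\<gamma>. Poly_Mapping.single i b + \<gamma> = \<alpha>} \<subseteq> Poly_Mapping.keys \<alpha>"
    using that by (auto simp: in_keys_iff lookup_add)
qed simp

lemma monomial_of_Cons: "monomial_of (i # is) (x # xs) = Poly_Mapping.single i x + monomial_of is xs"
  unfolding monomial_of_def by (simp add: sum.lessThan_Suc_shift del: sum.lessThan_Suc)

lemma monomial_of_update:
  assumes "j < length xs"
  shows "monomial_of is (xs[j := b + xs ! j]) = Poly_Mapping.single (is ! j) b + monomial_of is xs"
proof -
  have "monomial_of is (xs[j := b + xs ! j]) =
      (\<Sum>l<length xs. Poly_Mapping.single (is ! l) (xs ! l) + (if l = j then Poly_Mapping.single (is ! l) b else 0))"
    unfolding monomial_of_def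
    by (intro sum.cong) (auto simp: nth_list_update single_add add.commute)
  then show ?thesis using assms by (simp add: sum.distrib monomial_of_def add.commute)
qed

text \<open>In a product with \<open>p\<^sub>b\<close> the variable taken from \<open>p\<^sub>b\<close> is either new or equal to exactly one of the
  variables already present.\<close>
lemma power_sum_times_augmented_monomial:
  assumes b: "b > 0" and xs: "0 \<notin> set xs"
  shows "series_mult (power_sum b) (augmented_monomial xs) \<alpha> =
    augmented_monomial (b # xs) \<alpha> + (\<Sum>j<length xs. augmented_monomial (xs[j := b + xs ! j]) \<alpha>)"
proof -
  let ?I = "{i. \<exists>\<gamma>. Poly_Mapping.single i b + \<gamma> = \<alpha>}"
  let ?E = "{(i, is). length is = length xs \<and> distinct is \<and> Poly_Mapping.single i b + monomial_of is xs = \<alpha>}"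
  \<comment> \<open>\<open>?E\<close> is split according to whether the index from \<open>p\<^sub>b\<close> is new or the \<open>j\<close>-th one present.\<close>
  let ?new = "{(i, is) \<in> ?E. i \<notin> set is}"
  let ?old = "\<lambda>j. {(i, is) \<in> ?E. i = is ! j}"
  have E: "?E = (SIGMA i:?I. placements xs (\<alpha> - Poly_Mapping.single i b))"
    by (auto simp: placements_def)
  have finE: "finite ?E" unfolding E
    using finite_single_splittings[OF b] finite_placements[OF xs] by auto
  have "series_mult (power_sum b) (augmented_monomial xs) \<alpha> = of_nat (card ?E)"
    unfolding E series_mult_power_sum[OF b] augmented_monomial_def
    using finite_single_splittings[OF b] finite_placements[OF xs] by (subst card_SigmaI) auto
  also have "?E = ?new \<union> (\<Union>j<length xs. ?old j)"
    by (auto simp: in_set_conv_nth)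
  also have "card \<dots> = card ?new + card (\<Union>j<length xs. ?old j)"
    by (intro card_Un_disjoint finite_subset[OF _ finE]) auto
  also have "card (\<Union>j<length xs. ?old j) = (\<Sum>j<length xs. card (?old j))"
  proof (rule card_UN_disjoint)
    show "\<forall>j\<in>{..<length xs}. finite (?old j)" by (auto intro: finite_subset[OF _ finE])
    show "\<forall>i\<in>{..<length xs}. \<forall>j\<in>{..<length xs}. i \<noteq> j \<longrightarrow> ?old i \<inter> ?old j = {}"
      by (auto simp: nth_eq_iff_index_eq)
  qed simp
  also have "card ?new = card (placements (b # xs) \<alpha>)"
    by (rule bij_betw_same_card[of "\<lambda>(i, is). i # is"], rule bij_betwI[where g = "\<lambda>is. (hd is, tl is)"])
      (auto simp: placements_def monomial_of_Cons length_Suc_conv)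
  also have "(\<Sum>j<length xs. card (?old j)) = (\<Sum>j<length xs. card (placements (xs[j := b + xs ! j]) \<alpha>))"
  proof (rule sum.cong[OF refl])
    fix j assume "j \<in> {..<length xs}"
    then show "card (?old j) = card (placements (xs[j := b + xs ! j]) \<alpha>)"
      by (intro bij_betw_same_card[of snd] bij_betwI[where g = "\<lambda>is. (is ! j, is)"])
        (auto simp: placements_def monomial_of_update)
  qed
  finally show ?thesis by (simp add: augmented_monomial_def)
qed

definition power_sum_span :: "nat \<Rightarrow> series set" where
  "power_sum_span n = {F. \<exists>\<chi>. F = (\<lambda>\<alpha>. \<Sum>\<nu>\<in>partitions_of n. \<chi> \<nu> * power_sum_partition \<nu> \<alpha>)}"

lemma power_sum_span_lincomb:
  assumes "\<And>a. a \<in> A \<Longrightarrow> F a \<in> power_sum_span n"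
  shows "(\<lambda>\<alpha>. \<Sum>a\<in>A. c a * F a \<alpha>) \<in> power_sum_span n"
proof -
  have "\<forall>a. \<exists>\<chi>. a \<in> A \<longrightarrow> F a = (\<lambda>\<alpha>. \<Sum>\<nu>\<in>partitions_of n. \<chi> \<nu> * power_sum_partition \<nu> \<alpha>)"
    using assms by (auto simp: power_sum_span_def)
  then obtain \<chi> where \<chi>: "\<forall>a. a \<in> A \<longrightarrow> F a = (\<lambda>\<alpha>. \<Sum>\<nu>\<in>partitions_of n. \<chi> a \<nu> * power_sum_partition \<nu> \<alpha>)"
    by metis
  have "(\<Sum>a\<in>A. c a * F a \<alpha>) = (\<Sum>\<nu>\<in>partitions_of n. (\<Sum>a\<in>A. c a * \<chi> a \<nu>) * power_sum_partition \<nu> \<alpha>)" for \<alpha>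
  proof -
    have "(\<Sum>a\<in>A. c a * F a \<alpha>) = (\<Sum>a\<in>A. \<Sum>\<nu>\<in>partitions_of n. c a * \<chi> a \<nu> * power_sum_partition \<nu> \<alpha>)"
      using \<chi> by (simp add: sum_distrib_left mult.assoc)
    then show ?thesis by (subst (asm) sum.swap) (simp add: sum_distrib_right)
  qed
  then show ?thesis unfolding power_sum_span_def mem_Collect_eq
    by (intro exI[of _ "\<lambda>\<nu>. \<Sum>a\<in>A. c a * \<chi> a \<nu>"] ext)
qed

lemma power_sum_span_sum:
  assumes "\<And>a. a \<in> A \<Longrightarrow> F a \<in> power_sum_span n"
  shows "(\<lambda>\<alpha>. \<Sum>a\<in>A. F a \<alpha>) \<in> power_sum_span n"
  using power_sum_span_lincomb[where c = "\<lambda>_. 1", OF assms] by simp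

lemma power_sum_span_diff:
  assumes "F \<in> power_sum_span n" "G \<in> power_sum_span n"
  shows "(\<lambda>\<alpha>. F \<alpha> - G \<alpha>) \<in> power_sum_span n"
  using power_sum_span_lincomb[of UNIV "\<lambda>b. if b then F else G" n "\<lambda>b. if b then 1 else -1"] assms
  by (simp add: UNIV_bool)

lemma partition_of_mset:
  "rev (sorted_list_of_multiset M) \<in> partitions_of n" if "0 \<notin># M" "sum_mset M = n"
  using that
  by (auto simp: partitions_of_def is_partition_def sorted_wrt_rev sum_mset_sum_list[symmetric] mset_sorted_list_of_multiset)

lemma power_sum_partition_span:
  assumes "0 \<notin> set xs"
  shows "power_sum_partition xs \<in> power_sum_span (sum_list xs)"
proof -
  let ?\<nu> = "rev (sorted_list_of_multiset (mset xs))"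
  have "?\<nu> \<in> partitions_of (sum_list xs)"
    using assms by (intro partition_of_mset) (auto simp: sum_mset_sum_list)
  then have "power_sum_partition ?\<nu> = (\<lambda>\<alpha>. \<Sum>\<nu>\<in>partitions_of (sum_list xs).
      (if \<nu> = ?\<nu> then 1 else 0) * power_sum_partition \<nu> \<alpha>)"
    by (simp add: if_distrib[of "\<lambda>x. x * _"] finite_partitions_of cong: if_cong)
  moreover have "power_sum_partition ?\<nu> = power_sum_partition xs"
    by (rule power_sum_partition_mset) simp
  ultimately show ?thesis
    unfolding power_sum_span_def mem_Collect_eq by metis
qed

lemma power_sum_span_mult:
  assumes "F \<in> power_sum_span n" "b > 0"
  shows "series_mult (power_sum b) F \<in> power_sum_span (b + n)"
proof -
  obtain \<chi> where F: "F = (\<lambda>\<alpha>. \<Sum>\<nu>\<in>partitions_of n. \<chi> \<nu> * power_sum_partition \<nu> \<alpha>)"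
    using assms by (auto simp: power_sum_span_def)
  have "series_mult (power_sum b) F = (\<lambda>\<alpha>. \<Sum>\<nu>\<in>partitions_of n. \<chi> \<nu> * power_sum_partition (b # \<nu>) \<alpha>)"
  proof
    fix \<alpha>
    have "series_mult (power_sum b) F \<alpha> =
        (\<Sum>(\<beta>, \<gamma>) | \<beta> + \<gamma> = \<alpha>. \<Sum>\<nu>\<in>partitions_of n. \<chi> \<nu> * (power_sum b \<beta> * power_sum_partition \<nu> \<gamma>))"
      unfolding series_mult_def F by (simp add: sum_distrib_left mult_ac)
    also have "\<dots> = (\<Sum>\<nu>\<in>partitions_of n. \<Sum>(\<beta>, \<gamma>) | \<beta> + \<gamma> = \<alpha>. \<chi> \<nu> * (power_sum b \<beta> * power_sum_partition \<nu> \<gamma>))"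
      unfolding case_prod_beta by (rule sum.swap)
    also have "\<dots> = (\<Sum>\<nu>\<in>partitions_of n. \<chi> \<nu> * power_sum_partition (b # \<nu>) \<alpha>)"
      by (simp add: power_sum_partition_def series_mult_def sum_distrib_left case_prod_beta)
    finally show "series_mult (power_sum b) F \<alpha> = (\<Sum>\<nu>\<in>partitions_of n. \<chi> \<nu> * power_sum_partition (b # \<nu>) \<alpha>)" .
  qed
  moreover have "power_sum_partition (b # \<nu>) \<in> power_sum_span (b + n)" if "\<nu> \<in> partitions_of n" for \<nu>
    using power_sum_partition_span[of "b # \<nu>"] that \<open>b > 0\<close>
    by (auto simp: partitions_of_def is_partition_def)
  ultimately show ?thesis
    using power_sum_span_lincomb[of "partitions_of n" "\<lambda>\<nu>. power_sum_partition (b # \<nu>)" "b + n" \<chi>]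
    by simp
qed

text \<open>The product rule expresses the series of \<open>b # xs\<close> by a product with \<open>p\<^sub>b\<close> and series of shorter
  lists, which gives an induction on the number of parts.\<close>
lemma augmented_monomial_span:
  assumes "0 \<notin> set xs"
  shows "augmented_monomial xs \<in> power_sum_span (sum_list xs)"
  using assms
proof (induction "length xs" arbitrary: xs)
  case 0
  have "placements [] \<alpha> = (if \<alpha> = 0 then {[]} else {})" for \<alpha>
    by (auto simp: placements_def monomial_of_def)
  then have "augmented_monomial [] = power_sum_partition []"
    by (auto simp: augmented_monomial_def power_sum_partition_def series_one_def)
  then show ?case using 0 power_sum_partition_span[of "[]"] by simp
next
  case (Suc k)
  then obtain b ys where xs: "xs = b # ys" by (cases xs) auto
  have pos: "b > 0" "0 \<notin> set ys" using Suc.prems xs by auto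
  have "series_mult (power_sum b) (augmented_monomial ys) \<in> power_sum_span (sum_list xs)"
    using power_sum_span_mult Suc xs pos by simp
  moreover have "(\<lambda>\<alpha>. \<Sum>j<length ys. augmented_monomial (ys[j := b + ys ! j]) \<alpha>) \<in> power_sum_span (sum_list xs)"
  proof (rule power_sum_span_sum)
    fix j assume j: "j \<in> {..<length ys}"
    have "sum_list (ys[j := b + ys ! j]) = sum_list xs"
      using j member_le_sum_list[of "ys ! j" ys] by (simp add: sum_list_update xs)
    moreover have "0 \<notin> set (ys[j := b + ys ! j])"
      using pos set_update_subset_insert[of ys j "b + ys ! j"] by auto
    ultimately show "augmented_monomial (ys[j := b + ys ! j]) \<in> power_sum_span (sum_list xs)"
      using Suc.hyps(1)[of "ys[j := b + ys ! j]"] Suc.hyps(2) xs by simp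
  qed
  ultimately have "(\<lambda>\<alpha>. series_mult (power_sum b) (augmented_monomial ys) \<alpha> -
      (\<Sum>j<length ys. augmented_monomial (ys[j := b + ys ! j]) \<alpha>)) \<in> power_sum_span (sum_list xs)"
    by (rule power_sum_span_diff)
  then show ?case
    using power_sum_times_augmented_monomial[OF pos] xs by simp
qed

text \<open>A symmetric series is constant on the monomials with a given multiset of exponents, and on these
  exactly one of the series \<open>augmented_monomial \<nu>\<close> is nonzero. So the symmetric series is a linear
  combination of these, with coefficients read off at one monomial for each partition.\<close>
lemma symmetric_series_power_sum_span:
  assumes F: "symmetric_series F"
    and hom: "\<And>\<alpha>. F \<alpha> \<noteq> 0 \<Longrightarrow> sum_mset (exponents \<alpha>) = n"
  shows "F \<in> power_sum_span n"
proof -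
  \<comment> \<open>A representative monomial for each partition.\<close>
  define can where "can \<nu> = monomial_of [0..<length \<nu>] \<nu>" for \<nu>
  let ?M = augmented_monomial
  have "F = (\<lambda>\<alpha>. \<Sum>\<nu>\<in>partitions_of n. F (can \<nu>) / ?M \<nu> (can \<nu>) * ?M \<nu> \<alpha>)"
  proof
    fix \<alpha>
    let ?\<nu> = "rev (sorted_list_of_multiset (exponents \<alpha>))"
    have exps: "exponents \<alpha> = mset \<nu>" if "?M \<nu> \<alpha> \<noteq> 0" "\<nu> \<in> partitions_of n" for \<nu>
    proof -
      have "placements \<nu> \<alpha> \<noteq> {}" using that(1) by (auto simp: augmented_monomial_def)
      then show ?thesis
        using placements_exponents(2)[of _ \<nu> \<alpha>] that(2) by (auto simp: partitions_of_def is_partition_def)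
    qed
    show "F \<alpha> = (\<Sum>\<nu>\<in>partitions_of n. F (can \<nu>) / ?M \<nu> (can \<nu>) * ?M \<nu> \<alpha>)"
    proof (cases "sum_mset (exponents \<alpha>) = n")
      case False
      then have "?M \<nu> \<alpha> = 0" if "\<nu> \<in> partitions_of n" for \<nu>
        using exps[OF _ that] that by (cases "?M \<nu> \<alpha> = 0") (auto simp: partitions_of_def sum_mset_sum_list)
      then show ?thesis using False hom[of \<alpha>] by auto
    next
      case True
      have "0 \<notin># exponents \<alpha>" by (auto simp: exponents_def in_keys_iff)
      then have \<nu>: "?\<nu> \<in> partitions_of n" using partition_of_mset True by blast
      have uniq: "?M \<nu> \<alpha> = 0" if "\<nu> \<in> partitions_of n - {?\<nu>}" for \<nu>
      proof (rule ccontr)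
        assume "?M \<nu> \<alpha> \<noteq> 0"
        then have "mset (rev \<nu>) = exponents \<alpha>" using exps that by simp
        moreover have "sorted (rev \<nu>)" using that by (auto simp: partitions_of_def is_partition_def sorted_wrt_rev)
        ultimately have "rev \<nu> = sorted_list_of_multiset (exponents \<alpha>)"
          by (metis sorted_list_of_multiset_mset sorted_sort_id)
        then show False using that by (metis DiffE insertI1 rev_rev_ident)
      qed
      have "[0..<length ?\<nu>] \<in> placements ?\<nu> (can ?\<nu>)" by (simp add: placements_def can_def)
      moreover have z: "0 \<notin> set ?\<nu>" using \<nu> by (simp add: partitions_of_def is_partition_def)
      ultimately have "exponents (can ?\<nu>) = exponents \<alpha>" and nz: "?M ?\<nu> (can ?\<nu>) \<noteq> 0"
        using placements_exponents(2)[of _ ?\<nu> "can ?\<nu>"] finite_placements[OF z]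
        by (auto simp: augmented_monomial_def)
      then have "F (can ?\<nu>) = F \<alpha>" "?M ?\<nu> (can ?\<nu>) = ?M ?\<nu> \<alpha>"
        using symmetric_series_exponents F symmetric_augmented_monomial by blast+
      then have "F \<alpha> = F (can ?\<nu>) / ?M ?\<nu> (can ?\<nu>) * ?M ?\<nu> \<alpha>" using nz by simp
      also have "\<dots> = (\<Sum>\<nu>\<in>partitions_of n. F (can \<nu>) / ?M \<nu> (can \<nu>) * ?M \<nu> \<alpha>)"
        using uniq \<nu> finite_partitions_of by (subst sum.remove[of _ ?\<nu>]) auto
      finally show ?thesis .
    qed
  qed
  also have "\<dots> \<in> power_sum_span n"
    using augmented_monomial_span
    by (intro power_sum_span_lincomb) (auto simp: partitions_of_def is_partition_def)
  finally show ?thesis .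
qed

section \<open>Principal specialization\<close>

text \<open>The exponent of \<open>q\<close> that a monomial acquires under \<open>x\<^sub>i = q\<^bsup>i+1\<^esup>\<close>. With the exponent \<open>i + 1\<close>
  in place of \<open>i\<close>, only finitely many monomials have a given weight, so that every series can be specialized.\<close>
definition weight :: "(nat \<Rightarrow>\<^sub>0 nat) \<Rightarrow> nat" where
  "weight \<alpha> = (\<Sum>i\<in>Poly_Mapping.keys \<alpha>. Suc i * Poly_Mapping.lookup \<alpha> i)"

lemma weight_add: "weight (\<alpha> + \<beta>) = weight \<alpha> + weight \<beta>"
  unfolding weight_def by (rule setsum_keys_plus_distrib) (auto simp: algebra_simps)

lemma weight_0 [simp]: "weight 0 = 0"
  by (simp add: weight_def)

lemma weight_single [simp]: "weight (Poly_Mapping.single i k) = Suc i * k"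
  by (cases "k = 0") (simp_all add: weight_def)

lemma weight_sum: "weight (sum f A) = (\<Sum>a\<in>A. weight (f a))"
  by (induction A rule: infinite_finite_induct) (simp_all add: weight_add)

lemma finite_weight: "finite {\<alpha>. weight \<alpha> = N}"
proof -
  have le: "Suc i * Poly_Mapping.lookup \<alpha> i \<le> weight \<alpha>" if "i \<in> Poly_Mapping.keys \<alpha>" for \<alpha> i
    unfolding weight_def by (rule member_le_sum[OF that, of "\<lambda>i. Suc i * Poly_Mapping.lookup \<alpha> i"]) auto
  have bound: "i < weight \<alpha> \<and> Poly_Mapping.lookup \<alpha> i \<le> weight \<alpha>" if "i \<in> Poly_Mapping.keys \<alpha>" for \<alpha> i
  proof -
    have "Poly_Mapping.lookup \<alpha> i \<ge> 1" using that by (simp add: in_keys_iff)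
    then have "Suc i * 1 \<le> Suc i * Poly_Mapping.lookup \<alpha> i" "1 * Poly_Mapping.lookup \<alpha> i \<le> Suc i * Poly_Mapping.lookup \<alpha> i"
      by (intro mult_le_mono; simp)+
    then have "Suc i * 1 \<le> weight \<alpha>" "1 * Poly_Mapping.lookup \<alpha> i \<le> weight \<alpha>"
      using le[OF that] le_trans by blast+
    then show ?thesis by simp
  qed
  let ?g = "\<lambda>\<alpha>. restrict (Poly_Mapping.lookup \<alpha>) {..<N}"
  \<comment> \<open>A monomial of weight \<open>N\<close> involves only the first \<open>N\<close> variables, with exponents at most \<open>N\<close>.\<close>
  have "?g ` {\<alpha>. weight \<alpha> = N} \<subseteq> (\<Pi>\<^sub>E i\<in>{..<N}. {..N})"
  proof (clarsimp)
    fix \<alpha> i assume "N = weight \<alpha>" "i < weight \<alpha>"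
    then show "Poly_Mapping.lookup \<alpha> i \<le> weight \<alpha>"
      using bound[of i \<alpha>] by (cases "i \<in> Poly_Mapping.keys \<alpha>") (auto simp: in_keys_iff)
  qed
  then have "finite (?g ` {\<alpha>. weight \<alpha> = N})"
    by (rule finite_subset) (auto intro: finite_PiE)
  moreover have "inj_on ?g {\<alpha>. weight \<alpha> = N}"
  proof (rule inj_onI, rule poly_mapping_eqI)
    fix \<alpha> \<beta> i
    assume *: "\<alpha> \<in> {\<alpha>. weight \<alpha> = N}" "\<beta> \<in> {\<alpha>. weight \<alpha> = N}" "?g \<alpha> = ?g \<beta>"
    show "Poly_Mapping.lookup \<alpha> i = Poly_Mapping.lookup \<beta> i"
    proof (cases "i < N")
      case True
      then show ?thesis using fun_cong[OF *(3), of i] by simp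
    next
      case False
      then have "i \<notin> Poly_Mapping.keys \<alpha>" "i \<notin> Poly_Mapping.keys \<beta>"
        using bound[of i \<alpha>] bound[of i \<beta>] * by auto
      then show ?thesis by (simp add: in_keys_iff)
    qed
  qed
  ultimately show ?thesis by (rule finite_imageD)
qed

definition specialize :: "series \<Rightarrow> complex fps" where
  "specialize F = Abs_fps (\<lambda>N. \<Sum>\<alpha> | weight \<alpha> = N. F \<alpha>)"

lemma specialize_nth: "specialize F $ N = (\<Sum>\<alpha> | weight \<alpha> = N. F \<alpha>)"
  by (simp add: specialize_def)

lemma specialize_mult: "specialize (series_mult F G) = specialize F * specialize G"
proof (rule fps_ext)
  fix N
  have "specialize (series_mult F G) $ N =
      (\<Sum>\<alpha> | weight \<alpha> = N. \<Sum>p\<in>{(\<beta>, \<gamma>). \<beta> + \<gamma> = \<alpha>}. F (fst p) * G (snd p))"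
    by (simp add: specialize_nth series_mult_def case_prod_beta)
  also have "\<dots> = (\<Sum>(\<alpha>, p)\<in>(SIGMA \<alpha>:{\<alpha>. weight \<alpha> = N}. {(\<beta>, \<gamma>). \<beta> + \<gamma> = \<alpha>}). F (fst p) * G (snd p))"
    by (subst sum.Sigma) (auto simp: finite_weight finite_splittings)
  also have "\<dots> = (\<Sum>(i, p)\<in>(SIGMA i:{0..N}. {\<beta>. weight \<beta> = i} \<times> {\<gamma>. weight \<gamma> = N - i}). F (fst p) * G (snd p))"
    by (rule sum.reindex_bij_witness[where j = "\<lambda>(\<alpha>, p). (weight (fst p), p)"
          and i = "\<lambda>(i, p). (fst p + snd p, p)"]) (auto simp: weight_add)
  also have "\<dots> = (\<Sum>i=0..N. \<Sum>p\<in>{\<beta>. weight \<beta> = i} \<times> {\<gamma>. weight \<gamma> = N - i}. F (fst p) * G (snd p))"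
    by (subst sum.Sigma) (auto simp: finite_weight)
  also have "\<dots> = (specialize F * specialize G) $ N"
    by (simp add: fps_mult_nth specialize_nth sum_product sum.cartesian_product case_prod_beta)
  finally show "specialize (series_mult F G) $ N = (specialize F * specialize G) $ N" .
qed

lemma specialize_lincomb:
  "specialize (\<lambda>\<alpha>. \<Sum>a\<in>A. c a * F a \<alpha>) = (\<Sum>a\<in>A. fps_const (c a) * specialize (F a))"
proof (rule fps_ext)
  fix N
  show "specialize (\<lambda>\<alpha>. \<Sum>a\<in>A. c a * F a \<alpha>) $ N = (\<Sum>a\<in>A. fps_const (c a) * specialize (F a)) $ N"
    unfolding specialize_nth fps_sum_nth by (subst sum.swap) (simp add: specialize_nth sum_distrib_left)
qed

lemma specialize_one: "specialize series_one = 1"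
proof (rule fps_ext)
  fix N
  show "specialize series_one $ N = 1 $ N"
    unfolding specialize_nth series_one_def by (subst sum.delta) (auto simp: finite_weight)
qed

lemma specialize_power_sum:
  assumes "k > 0"
  shows "specialize (power_sum k) = fps_X ^ k * inverse (1 - fps_X ^ k)"
proof -
  have nth: "specialize (power_sum k) $ N = (if N > 0 \<and> k dvd N then 1 else 0)" for N
  proof -
    have "specialize (power_sum k) $ N = of_nat (card {\<alpha>. weight \<alpha> = N \<and> (\<exists>i. \<alpha> = Poly_Mapping.single i k)})"
      by (simp add: specialize_nth power_sum_def sum.If_cases finite_weight Collect_conj_eq)
    also have "{\<alpha>. weight \<alpha> = N \<and> (\<exists>i. \<alpha> = Poly_Mapping.single i k)} =
        (if N > 0 \<and> k dvd N then {Poly_Mapping.single (N div k - 1) k} else {})"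
    proof -
      have "Suc i * k = N \<longleftrightarrow> N > 0 \<and> k dvd N \<and> i = N div k - 1" for i
      proof
        assume "N > 0 \<and> k dvd N \<and> i = N div k - 1"
        moreover from this obtain l where "N = k * l" by (elim conjE dvdE)
        ultimately show "Suc i * k = N" using assms by (cases l) simp_all
      next
        assume *: "Suc i * k = N"
        have "N div k = Suc i" unfolding *[symmetric] using assms by simp
        moreover have "k dvd N" unfolding *[symmetric] by simp
        ultimately show "N > 0 \<and> k dvd N \<and> i = N div k - 1" using * assms by simp
      qed
      then show ?thesis by auto
    qed
    finally show ?thesis by auto
  qed
  have "specialize (power_sum k) * (1 - fps_X ^ k) = fps_X ^ k"
  proof (rule fps_ext)
    fix N
    have "k dvd N - k \<longleftrightarrow> k dvd N" if "N \<ge> k" using that by (metis dvd_minus_self not_le)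
    then show "(specialize (power_sum k) * (1 - fps_X ^ k)) $ N = fps_X ^ k $ N"
      using assms by (auto simp: right_diff_distrib fps_X_power_mult_right_nth nth fps_X_power_nth dest: dvd_imp_le)
  qed
  moreover have "(1 - fps_X ^ k :: complex fps) * inverse (1 - fps_X ^ k) = 1"
    using assms by (intro inverse_mult_eq_1') (simp add: fps_X_power_nth)
  ultimately show ?thesis by (metis mult.assoc mult.right_neutral)
qed

lemma specialize_power_sum_partition:
  assumes "0 \<notin> set \<nu>"
  shows "specialize (power_sum_partition \<nu>) =
    fps_X ^ sum_list \<nu> * (\<Prod>k\<leftarrow>\<nu>. inverse (1 - fps_X ^ k))"
  using assms
  by (induction \<nu>)
    (simp_all add: power_sum_partition_def specialize_one specialize_mult specialize_power_sum power_add mult_ac)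

lemma specialize_skew_schur:
  "specialize (skew_schur lam mu) $ N =
    of_nat (card {T \<in> SSYT lam mu. (\<Sum>b\<in>skew_diagram lam mu. Suc (T b)) = N})"
proof -
  let ?A = "\<lambda>\<alpha>. {T \<in> SSYT lam mu. tableau_monomial lam mu T = \<alpha>}"
  have "specialize (skew_schur lam mu) $ N = of_nat (\<Sum>\<alpha> | weight \<alpha> = N. card (?A \<alpha>))"
    by (simp add: specialize_nth skew_schur_def)
  also have "(\<Sum>\<alpha> | weight \<alpha> = N. card (?A \<alpha>)) = card (\<Union>\<alpha>\<in>{\<alpha>. weight \<alpha> = N}. ?A \<alpha>)"
    by (rule card_UN_disjoint[symmetric]) (auto simp: finite_weight finite_SSYT_monomial)
  also have "(\<Union>\<alpha>\<in>{\<alpha>. weight \<alpha> = N}. ?A \<alpha>) =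
      {T \<in> SSYT lam mu. (\<Sum>b\<in>skew_diagram lam mu. Suc (T b)) = N}"
    by (auto simp: tableau_monomial_def weight_sum)
  finally show ?thesis .
qed


text \<open>The generating function of the nonnegative integer vectors \<open>b\<close> by \<open>\<Sum>\<^sub>j w\<^sub>j b\<^sub>j\<close>. Each new coordinate
  is either \<open>0\<close> or can be lowered by one, which gives the recursion that characterizes multiplication by
  \<open>1 / (1 - q\<^bsup>w\<^esup>)\<close>.\<close>
lemma extensional_prod_fps:
  assumes "finite J" "\<And>j. j \<in> J \<Longrightarrow> w j > 0"
  shows "(\<Prod>j\<in>J. inverse (1 - fps_X ^ w j :: complex fps)) =
    Abs_fps (\<lambda>N. of_nat (card {b \<in> extensional J. (\<Sum>j\<in>J. w j * b j) = N}))"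
  using assms
proof (induction J rule: finite_induct)
  case empty
  have "{b :: 'a \<Rightarrow> nat. b = (\<lambda>x. undefined) \<and> 0 = N} = (if N = 0 then {\<lambda>x. undefined} else {})" for N :: nat
    by auto
  then show ?case by (auto simp: fps_eq_iff)
next
  case (insert j J)
  define S where "S K N = {b \<in> extensional K. (\<Sum>j\<in>K. w j * b j) = N}" for K and N :: nat
  have sum: "(\<Sum>i\<in>insert j J. w i * b i) = w j * b j + (\<Sum>i\<in>J. w i * b i)" for b
    using insert.hyps by simp
  have sum_upd: "(\<Sum>i\<in>J. w i * (if i = j then x else b i)) = (\<Sum>i\<in>J. w i * b i)" for b x
    using insert.hyps by (intro sum.cong) auto
  have wj: "w j > 0" using insert.prems by simp
  have fin: "finite (S K N)" if "finite K" "\<And>j. j \<in> K \<Longrightarrow> w j > 0" for K N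
  proof (rule finite_subset)
    have "b j \<le> N" if "b \<in> S K N" "j \<in> K" for b j
    proof -
      have "b j \<le> w j * b j" using \<open>j \<in> K\<close> \<open>\<And>j. j \<in> K \<Longrightarrow> w j > 0\<close>[of j] by simp
      also have "\<dots> \<le> (\<Sum>j\<in>K. w j * b j)" using that \<open>finite K\<close> by (intro member_le_sum) auto
      finally show ?thesis using that by (simp add: S_def)
    qed
    then show "S K N \<subseteq> K \<rightarrow>\<^sub>E {..N}" by (auto simp: S_def PiE_def)
    show "finite (K \<rightarrow>\<^sub>E {..N})" using that by (intro finite_PiE) auto
  qed
  have rec: "card (S (insert j J) N) = card (S J N) + (if w j \<le> N then card (S (insert j J) (N - w j)) else 0)" for N
  proof -
    have "S (insert j J) N = {b \<in> S (insert j J) N. b j = 0} \<union> {b \<in> S (insert j J) N. b j > 0}" by auto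
    also have "card \<dots> = card {b \<in> S (insert j J) N. b j = 0} + card {b \<in> S (insert j J) N. b j > 0}"
      using fin[of "insert j J" N] insert by (intro card_Un_disjoint) auto
    also have "card {b \<in> S (insert j J) N. b j = 0} = card (S J N)"
      by (rule bij_betw_same_card[of "\<lambda>b. b(j := undefined)"], rule bij_betwI[where g = "\<lambda>b. b(j := 0)"])
        (use insert.hyps in \<open>auto simp: S_def sum sum_upd extensional_def\<close>)
    also have "card {b \<in> S (insert j J) N. b j > 0} = (if w j \<le> N then card (S (insert j J) (N - w j)) else 0)"
    proof (cases "w j \<le> N")
      case True
      have "card {b \<in> S (insert j J) N. b j > 0} = card (S (insert j J) (N - w j))"
        by (rule bij_betw_same_card[of "\<lambda>b. b(j := b j - 1)"], rule bij_betwI[where g = "\<lambda>b. b(j := b j + 1)"])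
          (use insert.hyps True in \<open>auto simp: S_def sum sum_upd extensional_def diff_mult_distrib2\<close>)
      then show ?thesis using True by simp
    next
      case False
      have "w j \<le> w j * b j + x" if "b j > 0" for b :: "'a \<Rightarrow> nat" and x
        using that by (simp add: trans_le_add1)
      then have "{b \<in> S (insert j J) N. b j > 0} = {}" using False by (force simp: S_def sum)
      then show ?thesis by (simp only: False card.empty if_False)
    qed
    finally show ?thesis .
  qed
  have step: "Abs_fps (\<lambda>N. of_nat (card (S (insert j J) N))) * (1 - fps_X ^ w j) =
      (Abs_fps (\<lambda>N. of_nat (card (S J N))) :: complex fps)"
  proof (rule fps_ext)
    fix N
    show "(Abs_fps (\<lambda>N. of_nat (card (S (insert j J) N))) * (1 - fps_X ^ w j)) $ N =
      (Abs_fps (\<lambda>N. of_nat (card (S J N))) :: complex fps) $ N"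
      using rec[of N] by (simp add: right_diff_distrib fps_X_power_mult_right_nth)
  qed
  moreover have "(1 - fps_X ^ w j :: complex fps) * inverse (1 - fps_X ^ w j) = 1"
    using wj by (intro inverse_mult_eq_1') (simp add: fps_X_power_nth)
  ultimately have "Abs_fps (\<lambda>N. of_nat (card (S (insert j J) N))) =
      (Abs_fps (\<lambda>N. of_nat (card (S J N))) :: complex fps) * inverse (1 - fps_X ^ w j)"
    by (simp add: mult.assoc flip: step)
  then show ?case using insert by (simp add: S_def mult.commute)
qed

section \<open>Standardization\<close>

definition rank_on :: "'a set \<Rightarrow> ('a \<Rightarrow> 'b :: linorder) \<Rightarrow> 'a \<Rightarrow> nat" where
  "rank_on A f x = card {y \<in> A. f y \<le> f x}"

lemma rank_on_less_iff:
  assumes "finite A" "x \<in> A" "y \<in> A"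
  shows "rank_on A f x < rank_on A f y \<longleftrightarrow> f x < f y"
proof -
  have mono: "rank_on A f u \<le> rank_on A f v" if "f u \<le> f v" for u v
    unfolding rank_on_def using assms that by (intro card_mono) auto
  have "rank_on A f x < rank_on A f y" if "f x < f y"
  proof -
    have "y \<in> {z \<in> A. f z \<le> f y}" "y \<notin> {z \<in> A. f z \<le> f x}" using that assms by auto
    moreover have "{z \<in> A. f z \<le> f x} \<subseteq> {z \<in> A. f z \<le> f y}" using that by auto
    ultimately have "{z \<in> A. f z \<le> f x} \<subset> {z \<in> A. f z \<le> f y}" by blast
    then show ?thesis unfolding rank_on_def using assms(1) by (simp add: psubset_card_mono)
  qed
  then show ?thesis using mono[of y x] by (auto simp: not_less[symmetric])
qed

lemma bij_betw_rank_on: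
  assumes "finite A" "inj_on f A"
  shows "bij_betw (rank_on A f) A {1..card A}"
proof -
  have "inj_on (rank_on A f) A"
    using rank_on_less_iff[OF assms(1), of _ _ f] assms(2)
    by (metis inj_onI inj_on_contraD less_irrefl linorder_neqE)
  moreover have "rank_on A f ` A \<subseteq> {1..card A}"
    using assms by (auto simp: rank_on_def Suc_le_eq card_gt_0_iff intro!: card_mono)
  moreover have "card (rank_on A f ` A) = card {1..card A}"
    using calculation by (simp add: card_image)
  ultimately show ?thesis unfolding bij_betw_def by (simp add: card_subset_eq)
qed

lemma rank_on_unique:
  assumes "bij_betw g A {1..card A}" "\<And>x y. x \<in> A \<Longrightarrow> y \<in> A \<Longrightarrow> g x < g y \<Longrightarrow> f x < f y" "x \<in> A"
  shows "g x = rank_on A f x"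
proof -
  have iff: "f y \<le> f x \<longleftrightarrow> g y \<le> g x" if "y \<in> A" for y
    using assms(1) assms(2)[OF that \<open>x \<in> A\<close>] assms(2)[OF \<open>x \<in> A\<close> that] that \<open>x \<in> A\<close>
    by (metis bij_betw_imp_inj_on inj_on_contraD leD leI le_less linorder_neqE_nat order.asym order_refl)
  have "rank_on A f x = card {y \<in> A. g y \<le> g x}"
    unfolding rank_on_def using iff by (intro arg_cong[of _ _ card]) auto
  also have "\<dots> = card (g ` {y \<in> A. g y \<le> g x})"
    using assms(1) by (intro card_image[symmetric]) (auto simp: bij_betw_def intro: inj_on_subset)
  also have "g ` {y \<in> A. g y \<le> g x} = {1..g x}"
  proof (intro equalityI subsetI)
    fix k assume k: "k \<in> {1..g x}"
    moreover have "g x \<in> {1..card A}" using assms(1,3) by (auto simp: bij_betw_def)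
    ultimately have "k \<in> g ` A" using assms(1) by (auto simp: bij_betw_def)
    then show "k \<in> g ` {y \<in> A. g y \<le> g x}" using k by auto
  next
    fix k assume "k \<in> g ` {y \<in> A. g y \<le> g x}"
    moreover have "g ` A = {1..card A}" using assms(1) by (auto simp: bij_betw_def)
    ultimately show "k \<in> {1..g x}" by force
  qed
  finally show ?thesis by simp
qed

definition comaj :: "nat list \<Rightarrow> nat list \<Rightarrow> (nat \<times> nat \<Rightarrow> nat) \<Rightarrow> nat" where
  "comaj lam mu S = (\<Sum>j\<in>descents lam mu S. card (skew_diagram lam mu) - j)"

text \<open>The weakly increasing sequences that increase strictly at the positions in \<open>A\<close>, parametrized by their
  free increments \<open>b\<close>. The position \<open>0\<close> carries the initial value.\<close>
definition level :: "nat set \<Rightarrow> (nat \<Rightarrow> nat) \<Rightarrow> nat \<Rightarrow> nat" where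
  "level A b s = (\<Sum>j<s. b j + (if j \<in> A then 1 else 0))"

lemma level_Suc: "level A b (Suc s) = level A b s + b s + (if s \<in> A then 1 else 0)"
  by (simp add: level_def)

lemma level_mono: "s \<le> t \<Longrightarrow> level A b s \<le> level A b t"
  unfolding level_def by (intro sum_mono2) auto

lemma level_strict:
  assumes "j \<in> A" "s \<le> j" "j < t"
  shows "level A b s < level A b t"
proof -
  have "level A b s \<le> level A b j" using assms by (intro level_mono) auto
  also have "\<dots> < level A b (Suc j)" using assms by (simp add: level_Suc)
  also have "\<dots> \<le> level A b t" using assms by (intro level_mono) auto
  finally show ?thesis .
qed

text \<open>An increment at position \<open>j\<close> raises the \<open>n - j\<close> later values. This is where \<open>comaj\<close> comes from.\<close>
lemma sum_level:
  assumes "A \<subseteq> {..<n}"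
  shows "(\<Sum>s\<in>{1..n}. level A b s) = (\<Sum>j\<in>A. n - j) + (\<Sum>j<n. (n - j) * b j)"
proof -
  have gen: "(\<Sum>s\<in>{1..n}. \<Sum>j<s. g j) = (\<Sum>j<n. (n - j) * g j)" for g :: "nat \<Rightarrow> nat"
  proof (induction n)
    case (Suc n)
    have "(\<Sum>j<n. (Suc n - j) * g j) = (\<Sum>j<n. (n - j) * g j + g j)"
      by (intro sum.cong) (auto simp: Suc_diff_le)
    then show ?case using Suc by (simp add: sum.distrib)
  qed simp
  have "(\<Sum>s\<in>{1..n}. level A b s) = (\<Sum>j<n. (n - j) * b j) + (\<Sum>j<n. if j \<in> A then n - j else 0)"
    unfolding level_def gen sum.distrib[symmetric] by (intro sum.cong) (auto simp: distrib_left)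
  also have "(\<Sum>j<n. if j \<in> A then n - j else 0) = (\<Sum>j\<in>A. n - j)"
    using assms by (simp add: sum.If_cases Int_absorb1)
  finally show ?thesis by simp
qed

context skew_tableaux
begin

abbreviation (input) "n \<equiv> card (skew_diagram lam mu)"
abbreviation (input) "Des \<equiv> descents lam mu"

text \<open>Because of the skew shape, two boxes in this relative position are joined by a hook within the
  diagram.\<close>
lemma SSYT_southeast:
  assumes T: "T \<in> SSYT lam mu" and xy: "(r, c) \<in> D" "(r', c') \<in> D" "r \<le> r'" "c \<le> c'"
  shows "T (r, c) \<le> T (r', c')" "r < r' \<Longrightarrow> T (r, c) < T (r', c')"
proof -
  have m: "(r, c') \<in> D" by (rule skew_diagram_convex[OF xy(1,2)]) (use xy in auto)
  have 1: "T (r, c) \<le> T (r, c')" using SSYT_row[OF T xy(1) m xy(4)] .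
  have 2: "T (r, c') < T (r', c')" if "r < r'" using SSYT_col[OF T m xy(2) that] .
  show "T (r, c) \<le> T (r', c')" using 1 2 xy(3) by (cases "r = r'") auto
  show "r < r' \<Longrightarrow> T (r, c) < T (r', c')" using 1 2 by linarith
qed

lemma SYT_subset_SSYT: "S \<in> SYT lam mu \<Longrightarrow> S \<in> SSYT lam mu"
  unfolding SYT_def SSYT_def by (auto intro: less_imp_le)

lemma SYT_bij: "S \<in> SYT lam mu \<Longrightarrow> bij_betw S D {1..n}"
  by (simp add: SYT_def)

lemma SYT_range: "S \<in> SYT lam mu \<Longrightarrow> x \<in> D \<Longrightarrow> S x \<in> {1..n}"
  using SYT_bij bij_betwE by blast

lemma descents_iff:
  assumes S: "S \<in> SYT lam mu" and "x \<in> D" "y \<in> D" "S y = Suc (S x)"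
  shows "S x \<in> Des S \<longleftrightarrow> fst x < fst y"
proof -
  have inj: "inj_on S D" using SYT_bij[OF S] by (simp add: bij_betw_def)
  have "S x \<ge> 1" "S y \<le> n" using SYT_range[OF S] assms(2,3) by auto
  then have "S x \<in> {1..n - 1}" using assms by auto
  show ?thesis
  proof
    assume "S x \<in> Des S"
    then obtain r c r' c' where *: "(r, c) \<in> D" "(r', c') \<in> D" "S (r, c) = S x" "S (r', c') = S x + 1" "r < r'"
      unfolding descents_def by blast
    have "(r, c) = x" using inj_onD[OF inj *(3)] * assms(2) by blast
    moreover have "(r', c') = y" using inj_onD[OF inj, of "(r', c')" y] * assms(3,4) by simp
    ultimately show "fst x < fst y" using *(5) by auto
  next
    assume "fst x < fst y"
    moreover have "(fst x, snd x) \<in> D" "(fst y, snd y) \<in> D" using assms by auto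
    moreover have "S (fst x, snd x) = S x" "S (fst y, snd y) = S x + 1" using assms by auto
    ultimately show "S x \<in> Des S" using \<open>S x \<in> {1..n - 1}\<close> unfolding descents_def by blast
  qed
qed

text \<open>If \<open>j\<close> is not a descent, then \<open>j + 1\<close> lies weakly above \<open>j\<close>, and hence strictly to the right of it,
  as otherwise it would lie weakly northwest and carry a smaller entry.\<close>
lemma SYT_descent_or_east:
  assumes S: "S \<in> SYT lam mu" and "x \<in> D" "y \<in> D" "S x < S y"
  shows "(\<exists>j\<in>Des S. S x \<le> j \<and> j < S y) \<or> snd x < snd y"
  using assms(3,4)
proof (induction "S y" arbitrary: y)
  case (Suc k)
  have img: "S ` D = {1..n}" using SYT_bij[OF S] by (simp add: bij_betw_def)
  have "S x \<ge> 1" "S y \<le> n" using img \<open>x \<in> D\<close> \<open>y \<in> D\<close> by auto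
  then have "k \<in> S ` D" using img Suc by auto
  then obtain w where w: "w \<in> D" "S w = k" by auto
  have wy: "k \<in> Des S \<or> snd w < snd y"
  proof (rule disjCI)
    assume "\<not> snd w < snd y"
    have "\<not> fst y \<le> fst w"
      using SSYT_southeast(1)[OF SYT_subset_SSYT[OF S], of "fst y" "snd y" "fst w" "snd w"]
        \<open>\<not> snd w < snd y\<close> w Suc by auto
    then show "k \<in> Des S" using descents_iff[OF S w(1) \<open>y \<in> D\<close>] w Suc by simp
  qed
  show ?case
  proof (cases "S x = k")
    case True
    then have "x = w" using w \<open>x \<in> D\<close> SYT_bij[OF S] by (auto simp: bij_betw_def inj_on_def)
    then show ?thesis using wy True Suc by force
  next
    case False
    then have "(\<exists>j\<in>Des S. S x \<le> j \<and> j < k) \<or> snd x < snd w"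
      using Suc.hyps(1)[of w] w Suc by simp
    then show ?thesis using wy False Suc by (metis less_Suc_eq less_trans not_less_eq order_less_imp_le)
  qed
qed simp

definition destandardize :: "(nat \<times> nat \<Rightarrow> nat) \<Rightarrow> (nat \<Rightarrow> nat) \<Rightarrow> (nat \<times> nat \<Rightarrow> nat)" where
  "destandardize S b = restrict (\<lambda>x. level (Des S) b (S x)) D"

text \<open>Boxes are ordered by their entries, and equal entries from left to right.\<close>
definition standardize :: "(nat \<times> nat \<Rightarrow> nat) \<Rightarrow> (nat \<times> nat \<Rightarrow> nat)" where
  "standardize T = restrict (rank_on D (\<lambda>x. (T x, snd x))) D"

lemma destandardize_key:
  assumes "S \<in> SYT lam mu" "x \<in> D" "y \<in> D" "S x < S y"
  shows "(destandardize S b x, snd x) < (destandardize S b y, snd y)"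
proof (cases "\<exists>j\<in>Des S. S x \<le> j \<and> j < S y")
  case True
  then have "destandardize S b x < destandardize S b y"
    using assms(2,3) by (auto simp: destandardize_def intro: level_strict)
  then show ?thesis by simp
next
  case False
  then have "snd x < snd y" using SYT_descent_or_east[OF assms] by blast
  moreover have "destandardize S b x \<le> destandardize S b y"
    using assms(2-4) by (simp add: destandardize_def level_mono)
  ultimately show ?thesis by simp
qed

lemma destandardize_SSYT:
  assumes S: "S \<in> SYT lam mu"
  shows "destandardize S b \<in> SSYT lam mu"
proof -
  let ?T = "destandardize S b"
  have row: "?T (r, c) \<le> ?T (r, c')" if "(r, c) \<in> D" "(r, c') \<in> D" "c < c'" for r c c'
  proof -
    have "S (r, c) < S (r, c')" using S that unfolding SYT_def by blast
    then show ?thesis using destandardize_key[OF S that(1,2), of b] by auto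
  qed
  have col: "?T (r, c) < ?T (r', c)" if "(r, c) \<in> D" "(r', c) \<in> D" "r < r'" for r r' c
  proof -
    have "S (r, c) < S (r', c)" using S that unfolding SYT_def by blast
    then show ?thesis using destandardize_key[OF S that(1,2), of b] by auto
  qed
  have "?T \<in> extensional D" by (simp add: destandardize_def)
  then show ?thesis using row col by (simp add: SSYT_def)
qed

lemma standardize_destandardize:
  assumes S: "S \<in> SYT lam mu"
  shows "standardize (destandardize S b) = S"
proof
  fix x
  show "standardize (destandardize S b) x = S x"
  proof (cases "x \<in> D")
    case True
    have "S x = rank_on D (\<lambda>x. (destandardize S b x, snd x)) x"
      by (rule rank_on_unique[OF SYT_bij[OF S]]) (use destandardize_key[OF S] True in auto)
    then show ?thesis using True by (simp add: standardize_def)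
  next
    case False
    have "S \<in> extensional D" using S by (simp add: SYT_def)
    then have "S x = undefined" using False by (rule extensional_arb)
    then show ?thesis using False by (simp add: standardize_def)
  qed
qed

lemma standardize_less_iff:
  assumes "x \<in> D" "y \<in> D"
  shows "standardize T x < standardize T y \<longleftrightarrow> (T x, snd x) < (T y, snd y)"
  using rank_on_less_iff[OF finite_skew_diagram assms, where f = "\<lambda>x. (T x, snd x)"] assms
  by (simp add: standardize_def)

lemma standardize_SYT:
  assumes T: "T \<in> SSYT lam mu"
  shows "standardize T \<in> SYT lam mu"
proof -
  let ?S = "standardize T"
  have "inj_on (\<lambda>x. (T x, snd x)) D"
  proof (rule inj_onI)
    fix x y assume *: "x \<in> D" "y \<in> D" "(T x, snd x) = (T y, snd y)"
    then obtain r r' c where "x = (r, c)" "y = (r', c)" by (cases x; cases y) auto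
    then show "x = y"
      using * SSYT_col[OF T, of r c r'] SSYT_col[OF T, of r' c r] by (cases r r' rule: linorder_cases) auto
  qed
  then have bij: "bij_betw (rank_on D (\<lambda>x. (T x, snd x))) D {1..n}"
    by (rule bij_betw_rank_on[OF finite_skew_diagram])
  have "bij_betw ?S D {1..n}"
    using bij by (rule iffD1[OF bij_betw_cong, rotated]) (simp add: standardize_def)
  moreover have "?S (r, c) < ?S (r, c')" if "(r, c) \<in> D" "(r, c') \<in> D" "c < c'" for r c c'
    using SSYT_row[OF T that(1,2)] that by (auto simp: standardize_less_iff)
  moreover have "?S (r, c) < ?S (r', c)" if "(r, c) \<in> D" "(r', c) \<in> D" "r < r'" for r r' c
    using SSYT_col[OF T that] that by (auto simp: standardize_less_iff)
  moreover have "?S \<in> extensional D" by (simp add: standardize_def)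
  ultimately show ?thesis by (simp add: SYT_def)
qed

text \<open>The entries of \<open>T\<close>, read in the order of its standardization, increase weakly, and strictly at each
  descent: equal entries are read from left to right, while a descent moves down, and an entry strictly below
  and to the right of another one is strictly larger.\<close>
lemma destandardize_surj:
  assumes T: "T \<in> SSYT lam mu"
  shows "\<exists>b \<in> extensional {..<n}. T = destandardize (standardize T) b"
proof -
  define S where "S = standardize T"
  have S: "S \<in> SYT lam mu" using standardize_SYT[OF T] by (simp add: S_def)
  note bij = SYT_bij[OF S]
  \<comment> \<open>The entries of \<open>T\<close> in standardization order, preceded by \<open>0\<close> so that the first increment is the least entry.\<close>
  define a where "a s = (if s = 0 then 0 else T (inv_into D S s))" for s
  define b where "b = restrict (\<lambda>j. a (Suc j) - a j - (if j \<in> Des S then 1 else 0)) {..<n}"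
  have "0 \<notin> Des S" by (simp add: descents_def)
  have step: "a j + (if j \<in> Des S then 1 else 0) \<le> a (Suc j)" if "j < n" for j
  proof (cases "j = 0")
    case True
    then show ?thesis using \<open>0 \<notin> Des S\<close> by (simp add: a_def)
  next
    case False
    define x y where "x = inv_into D S j" and "y = inv_into D S (Suc j)"
    have "j \<in> S ` D" "Suc j \<in> S ` D" using bij that False by (auto simp: bij_betw_def)
    then have xy: "x \<in> D" "y \<in> D" "S x = j" "S y = Suc j"
      by (auto simp: x_def y_def f_inv_into_f inv_into_into)
    then have key: "(T x, snd x) < (T y, snd y)"
      using standardize_less_iff[of x y T] by (simp add: S_def)
    have "T x < T y" if "j \<in> Des S"
    proof -
      have "fst x < fst y" using descents_iff[OF S xy(1,2)] xy that by simp
      then show ?thesis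
        using key SSYT_southeast(2)[OF T, of "fst x" "snd x" "fst y" "snd y"] xy by auto
    qed
    then show ?thesis using key False by (auto simp: a_def x_def y_def)
  qed
  have level_a: "level (Des S) b s = a s" if "s \<le> n" for s
    using that
  proof (induction s)
    case 0
    then show ?case by (simp add: level_def a_def)
  next
    case (Suc s)
    then show ?case using step[of s] by (auto simp: level_Suc b_def)
  qed
  have in_D: "destandardize S b x = T x" if "x \<in> D" for x
  proof -
    have "S x \<le> n" "S x \<noteq> 0" "inv_into D S (S x) = x"
      using SYT_range[OF S that] bij that by (auto simp: bij_betw_def)
    then show ?thesis using that level_a[of "S x"] unfolding destandardize_def a_def by simp
  qed
  have "T = destandardize S b"
  proof
    fix x show "T x = destandardize S b x"
    proof (cases "x \<in> D")
      case False
      have "T \<in> extensional D" using T by (simp add: SSYT_def)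
      then have "T x = undefined" using False by (rule extensional_arb)
      then show ?thesis using False by (simp add: destandardize_def)
    qed (simp add: in_D)
  qed
  moreover have "b \<in> extensional {..<n}" by (simp add: b_def)
  ultimately show ?thesis unfolding S_def by blast
qed

lemma destandardize_inj:
  assumes S: "S \<in> SYT lam mu"
  shows "inj_on (destandardize S) (extensional {..<n})"
proof (rule inj_onI)
  fix b b' assume ext: "b \<in> extensional {..<n}" "b' \<in> extensional {..<n}"
    and eq: "destandardize S b = destandardize S b'"
  have lev: "level (Des S) b s = level (Des S) b' s" if "s \<le> n" for s
  proof (cases "s = 0")
    case False
    then have "s \<in> S ` D" using SYT_bij[OF S] that by (auto simp: bij_betw_def)
    then obtain x where "x \<in> D" "S x = s" by auto
    then show ?thesis using fun_cong[OF eq, of x] by (simp add: destandardize_def)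
  qed (simp add: level_def)
  show "b = b'"
  proof (rule extensionalityI[OF ext])
    fix j assume "j \<in> {..<n}"
    then show "b j = b' j" using lev[of j] lev[of "Suc j"] by (simp add: level_Suc)
  qed
qed

lemma destandardize_weight:
  assumes S: "S \<in> SYT lam mu"
  shows "(\<Sum>x\<in>D. Suc (destandardize S b x)) = n + comaj lam mu S + (\<Sum>j<n. (n - j) * b j)"
proof -
  have "(\<Sum>x\<in>D. destandardize S b x) = (\<Sum>x\<in>D. level (Des S) b (S x))"
    by (intro sum.cong) (auto simp: destandardize_def)
  also have "\<dots> = (\<Sum>s\<in>{1..n}. level (Des S) b s)"
    by (rule sum.reindex_bij_betw[OF SYT_bij[OF S]])
  also have "\<dots> = comaj lam mu S + (\<Sum>j<n. (n - j) * b j)"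
    unfolding comaj_def by (rule sum_level) (auto simp: descents_def)
  finally show ?thesis by (simp add: sum_Suc)
qed

text \<open>The semistandard tableaux correspond to the pairs of a standard tableau \<open>S\<close> and a vector of free
  increments, and the weight of the tableau is \<open>n + comaj S\<close> plus a linear function of the increments.\<close>
lemma specialize_skew_schur_SYT:
  "specialize (skew_schur lam mu) =
    (\<Sum>S\<in>SYT lam mu. fps_X ^ (n + comaj lam mu S)) * (\<Prod>j<n. inverse (1 - fps_X ^ (n - j)))"
proof (rule fps_ext)
  fix N
  let ?w = "\<lambda>b. \<Sum>j<n. (n - j) * b j"
  let ?P = "\<Prod>j<n. inverse (1 - fps_X ^ (n - j)) :: complex fps"
  let ?B = "\<lambda>S. {b \<in> extensional {..<n}. n + comaj lam mu S + ?w b = N}"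
  have P: "?P = Abs_fps (\<lambda>N. of_nat (card {b \<in> extensional {..<n}. ?w b = N}))"
    by (rule extensional_prod_fps) auto
  have fin: "finite {T \<in> SSYT lam mu. (\<Sum>x\<in>D. Suc (T x)) = N}"
  proof (rule finite_subset)
    show "{T \<in> SSYT lam mu. (\<Sum>x\<in>D. Suc (T x)) = N} \<subseteq> D \<rightarrow>\<^sub>E {..N}"
    proof
      fix T assume "T \<in> {T \<in> SSYT lam mu. (\<Sum>x\<in>D. Suc (T x)) = N}"
      then have T: "T \<in> SSYT lam mu" and N: "N = (\<Sum>x\<in>D. Suc (T x))" by auto
      have "T x \<le> N" if "x \<in> D" for x
        using member_le_sum[OF that, of "\<lambda>x. Suc (T x)"] finite_skew_diagram N by force
      moreover have "T \<in> extensional D" using T by (simp add: SSYT_def)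
      ultimately show "T \<in> D \<rightarrow>\<^sub>E {..N}" by (auto simp: PiE_def)
    qed
    show "finite (D \<rightarrow>\<^sub>E {..N})" by (intro finite_PiE finite_skew_diagram) simp
  qed
  have eq: "{T \<in> SSYT lam mu. (\<Sum>x\<in>D. Suc (T x)) = N} = (\<Union>S\<in>SYT lam mu. destandardize S ` ?B S)"
  proof (intro equalityI subsetI)
    fix T assume "T \<in> {T \<in> SSYT lam mu. (\<Sum>x\<in>D. Suc (T x)) = N}"
    then have T: "T \<in> SSYT lam mu" "(\<Sum>x\<in>D. Suc (T x)) = N" by auto
    note S = standardize_SYT[OF T(1)]
    obtain b where b: "b \<in> extensional {..<n}" "T = destandardize (standardize T) b"
      using destandardize_surj[OF T(1)] by blast
    have "b \<in> ?B (standardize T)"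
      using destandardize_weight[OF S, of b] T(2) b by simp
    then show "T \<in> (\<Union>S\<in>SYT lam mu. destandardize S ` ?B S)" using S b(2) by blast
  next
    fix T assume "T \<in> (\<Union>S\<in>SYT lam mu. destandardize S ` ?B S)"
    then obtain S b where S: "S \<in> SYT lam mu" and b: "b \<in> ?B S" and T: "T = destandardize S b"
      by blast
    have "(\<Sum>x\<in>D. Suc (T x)) = N"
      unfolding T destandardize_weight[OF S] using b by simp
    then show "T \<in> {T \<in> SSYT lam mu. (\<Sum>x\<in>D. Suc (T x)) = N}"
      using destandardize_SSYT[OF S] T by blast
  qed
  have "card {T \<in> SSYT lam mu. (\<Sum>x\<in>D. Suc (T x)) = N} = (\<Sum>S\<in>SYT lam mu. card (destandardize S ` ?B S))"
    unfolding eq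
  proof (rule card_UN_disjoint)
    show "\<forall>S\<in>SYT lam mu. finite (destandardize S ` ?B S)"
    proof
      fix S assume "S \<in> SYT lam mu"
      then have "destandardize S ` ?B S \<subseteq> (\<Union>S\<in>SYT lam mu. destandardize S ` ?B S)" by blast
      then show "finite (destandardize S ` ?B S)" by (rule finite_subset) (rule fin[unfolded eq])
    qed
    show "\<forall>S\<in>SYT lam mu. \<forall>S'\<in>SYT lam mu. S \<noteq> S' \<longrightarrow> destandardize S ` ?B S \<inter> destandardize S' ` ?B S' = {}"
    proof (intro ballI impI)
      fix S S' assume "S \<in> SYT lam mu" "S' \<in> SYT lam mu" "S \<noteq> S'"
      then have "destandardize S b \<noteq> destandardize S' b'" for b b'
        using standardize_destandardize[of S b] standardize_destandardize[of S' b'] by auto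
      then show "destandardize S ` ?B S \<inter> destandardize S' ` ?B S' = {}" by blast
    qed
  qed (rule finite_SYT)
  also have "\<dots> = (\<Sum>S\<in>SYT lam mu. card (?B S))"
    using destandardize_inj by (intro sum.cong card_image refl) (auto intro: inj_on_subset)
  finally have "specialize (skew_schur lam mu) $ N = (\<Sum>S\<in>SYT lam mu. of_nat (card (?B S)))"
    by (simp add: specialize_skew_schur)
  also have "\<dots> = (\<Sum>S\<in>SYT lam mu. (fps_X ^ (n + comaj lam mu S) * ?P) $ N)"
  proof (rule sum.cong[OF refl])
    fix S
    have "?B S = (if N < n + comaj lam mu S then {} else {b \<in> extensional {..<n}. ?w b = N - (n + comaj lam mu S)})"
      by auto
    then show "of_nat (card (?B S)) = (fps_X ^ (n + comaj lam mu S) * ?P) $ N"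
      unfolding P by (simp add: fps_X_power_mult_nth)
  qed
  also have "\<dots> = ((\<Sum>S\<in>SYT lam mu. fps_X ^ (n + comaj lam mu S)) * ?P) $ N"
    by (simp add: sum_distrib_right fps_sum_nth)
  finally show "specialize (skew_schur lam mu) $ N =
      ((\<Sum>S\<in>SYT lam mu. fps_X ^ (n + comaj lam mu S)) * ?P) $ N" .
qed

end

section \<open>Values of power series at a root of unity\<close>

text \<open>Evaluation on the local ring of rational functions that are regular at \<open>w\<close>, viewed inside the formal
  power series. It makes a limit at \<open>w\<close> available without any analysis, even though the series in question
  need not converge there.\<close>
definition has_value_at :: "complex fps \<Rightarrow> complex \<Rightarrow> complex \<Rightarrow> bool" where
  "has_value_at F w v \<longleftrightarrow>
     (\<exists>P Q. poly Q w \<noteq> 0 \<and> F * fps_of_poly Q = fps_of_poly P \<and> poly P w = v * poly Q w)"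

lemma has_value_at_poly: "has_value_at (fps_of_poly P) w (poly P w)"
  unfolding has_value_at_def by (intro exI[of _ P] exI[of _ 1]) simp

lemma has_value_at_unique: "has_value_at (fps_of_poly P) w v \<Longrightarrow> poly P w = v"
  unfolding has_value_at_def by (auto simp flip: fps_of_poly_mult simp: fps_of_poly_eq_iff)

lemma has_value_at_inverse:
  assumes "poly U w \<noteq> 0" "coeff U 0 \<noteq> 0"
  shows "has_value_at (inverse (fps_of_poly U)) w (inverse (poly U w))"
  unfolding has_value_at_def using assms
  by (intro exI[of _ 1] exI[of _ U]) (simp add: inverse_mult_eq_1)

lemma has_value_at_add:
  assumes "has_value_at F w u" "has_value_at G w v"
  shows "has_value_at (F + G) w (u + v)"
proof -
  obtain P Q where 1: "poly Q w \<noteq> 0" "F * fps_of_poly Q = fps_of_poly P" "poly P w = u * poly Q w"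
    using assms(1) by (auto simp: has_value_at_def)
  obtain P' Q' where 2: "poly Q' w \<noteq> 0" "G * fps_of_poly Q' = fps_of_poly P'" "poly P' w = v * poly Q' w"
    using assms(2) by (auto simp: has_value_at_def)
  have "(F + G) * fps_of_poly (Q * Q') = fps_of_poly (P * Q' + P' * Q)"
    by (simp add: fps_of_poly_mult fps_of_poly_add algebra_simps flip: 1(2) 2(2))
  then show ?thesis unfolding has_value_at_def using 1 2
    by (intro exI[of _ "P * Q' + P' * Q"] exI[of _ "Q * Q'"]) (simp add: algebra_simps)
qed

lemma has_value_at_mult:
  assumes "has_value_at F w u" "has_value_at G w v"
  shows "has_value_at (F * G) w (u * v)"
proof -
  obtain P Q where 1: "poly Q w \<noteq> 0" "F * fps_of_poly Q = fps_of_poly P" "poly P w = u * poly Q w"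
    using assms(1) by (auto simp: has_value_at_def)
  obtain P' Q' where 2: "poly Q' w \<noteq> 0" "G * fps_of_poly Q' = fps_of_poly P'" "poly P' w = v * poly Q' w"
    using assms(2) by (auto simp: has_value_at_def)
  have "(F * G) * fps_of_poly (Q * Q') = fps_of_poly (P * P')"
    by (simp add: fps_of_poly_mult algebra_simps flip: 1(2) 2(2))
  then show ?thesis unfolding has_value_at_def using 1 2
    by (intro exI[of _ "P * P'"] exI[of _ "Q * Q'"]) simp
qed

lemma has_value_at_const: "has_value_at (fps_const c) w c"
  using has_value_at_poly[of "[:c:]" w] by (simp add: fps_of_poly_const)

lemma has_value_at_1: "has_value_at 1 w 1"
  using has_value_at_const[of 1 w] by simp

lemma has_value_at_sum:
  assumes "\<And>a. a \<in> A \<Longrightarrow> has_value_at (F a) w (v a)"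
  shows "has_value_at (\<Sum>a\<in>A. F a) w (\<Sum>a\<in>A. v a)"
  using assms
proof (induction A rule: infinite_finite_induct)
  case (insert a A)
  then show ?case by (simp add: has_value_at_add)
qed (use has_value_at_const[of 0] in auto)

lemma has_value_at_prod:
  assumes "\<And>a. a \<in> A \<Longrightarrow> has_value_at (F a) w (v a)"
  shows "has_value_at (\<Prod>a\<in>A. F a) w (\<Prod>a\<in>A. v a)"
  using assms
proof (induction A rule: infinite_finite_induct)
  case (insert a A)
  then show ?case by (simp add: has_value_at_mult)
qed (use has_value_at_1 in auto)

lemma has_value_at_prod_list:
  assumes "\<And>a. a \<in> set xs \<Longrightarrow> has_value_at (F a) w (v a)"
  shows "has_value_at (\<Prod>a\<leftarrow>xs. F a) w (\<Prod>a\<leftarrow>xs. v a)"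
  using assms
proof (induction xs)
  case (Cons a xs)
  then show ?case by (simp add: has_value_at_mult)
qed (use has_value_at_1 in auto)

lemma has_value_at_power: "has_value_at F w v \<Longrightarrow> has_value_at (F ^ k) w (v ^ k)"
proof (induction k)
  case (Suc k)
  then show ?case by (simp add: has_value_at_mult)
qed (use has_value_at_1 in auto)

lemma primitive_root_power_eq_1_iff:
  assumes "primitive_root_of_unity m w" "m > 0"
  shows "w ^ k = 1 \<longleftrightarrow> m dvd k"
proof -
  have "w ^ k = (w ^ m) ^ (k div m) * w ^ (k mod m)"
    by (simp flip: power_add power_mult)
  also have "\<dots> = w ^ (k mod m)"
    using assms by (simp add: primitive_root_of_unity_def)
  finally have "w ^ k = w ^ (k mod m)" .
  moreover have "w ^ (k mod m) = 1 \<longleftrightarrow> k mod m = 0"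
    using assms mod_less_divisor[of m k] by (cases "k mod m = 0") (auto simp: primitive_root_of_unity_def)
  ultimately show ?thesis by (simp add: dvd_eq_mod_eq_0)
qed

text \<open>Evaluate \<open>\<Prod>\<^sub>j (x - w\<^sup>j) = 1 + x + \<dots> + x\<^bsup>m-1\<^esup>\<close> at \<open>x = 1\<close>.\<close>
lemma prod_one_minus_roots_of_unity:
  assumes w: "primitive_root_of_unity m w" and m: "m > 0"
  shows "(\<Prod>j\<in>{1..<m}. 1 - w ^ j) = of_nat m"
proof -
  note iff = primitive_root_power_eq_1_iff[OF w m]
  let ?P = "\<Prod>j\<in>{1..<m}. [:- (w ^ j), 1:]"
  let ?Q = "\<Sum>i<m. monom 1 i :: complex poly"
  let ?A = "(\<lambda>j. w ^ j) ` {1..<m}"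
  have w0: "w \<noteq> 0" using w m by (auto simp: primitive_root_of_unity_def power_0_left)
  have inj: "inj_on (\<lambda>j. w ^ j) {1..<m}"
  proof (rule linorder_inj_onI')
    fix i j assume "i \<in> {1..<m}" "j \<in> {1..<m}" "i < j"
    then have "\<not> m dvd (j - i)" by (auto dest: dvd_imp_le)
    moreover have "w ^ j = w ^ i * w ^ (j - i)" using \<open>i < j\<close> by (simp flip: power_add)
    ultimately show "w ^ i \<noteq> w ^ j" using w0 iff[of "j - i"] by auto
  qed
  have deg: "degree ?P = m - 1"
    by (subst degree_prod_eq_sum_degree) auto
  have "?P = ?Q"
  proof (rule poly_eqI_degree_lead_coeff[where n = "m - 1" and A = ?A])
    have "coeff ?P (m - 1) = lead_coeff ?P" by (simp only: deg)
    also have "\<dots> = 1" by (simp add: lead_coeff_prod)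
    finally show "coeff ?P (m - 1) = coeff ?Q (m - 1)" using m by (simp add: coeff_sum coeff_monom)
    show "m - 1 \<le> card ?A" using inj by (simp add: card_image)
    show "degree ?P \<le> m - 1" using deg by simp
    show "degree ?Q \<le> m - 1"
      by (rule degree_sum_le) (auto intro: order.trans[OF degree_monom_le])
    fix x assume "x \<in> ?A"
    then obtain j where j: "j \<in> {1..<m}" "x = w ^ j" by auto
    have "x \<noteq> 1" using j iff[of j] by (auto dest: dvd_imp_le)
    moreover have "x ^ m = (w ^ m) ^ j" by (simp add: j(2) mult.commute flip: power_mult)
    then have "x ^ m = 1" using w by (simp add: primitive_root_of_unity_def)
    ultimately have "(\<Sum>i<m. x ^ i) = 0" using one_diff_power_eq[of x m] by simp
    moreover have "poly ?P x = 0" using j by (auto simp: poly_prod)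
    ultimately show "poly ?P x = poly ?Q x" by (simp add: poly_sum poly_monom)
  qed
  then have "poly ?P 1 = poly ?Q 1" by simp
  then show ?thesis by (simp add: poly_prod poly_sum poly_monom)
qed

text \<open>What remains of \<open>1 - x\<^sup>k\<close> after its zero at the primitive \<open>m\<close>-th roots of unity has been split off as a
  factor \<open>1 - x\<^sup>m\<close>.\<close>
definition reduced_factor :: "nat \<Rightarrow> nat \<Rightarrow> complex poly" where
  "reduced_factor m k = (if m dvd k then \<Sum>t<k div m. monom 1 (m * t) else 1 - monom 1 k)"

lemma one_minus_power_factor:
  "1 - fps_X ^ k = (if m dvd k then 1 - fps_X ^ m else 1) * fps_of_poly (reduced_factor m k)"
proof (cases "m dvd k")
  case True
  have "1 - fps_X ^ k = 1 - (fps_X ^ m :: complex fps) ^ (k div m)"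
    using True by (simp flip: power_mult)
  also have "\<dots> = (1 - fps_X ^ m) * (\<Sum>t<k div m. (fps_X ^ m) ^ t)" by (rule one_diff_power_eq)
  finally show ?thesis using True
    by (simp add: reduced_factor_def fps_of_poly_sum fps_of_poly_monom' power_mult)
next
  case False
  then show ?thesis by (simp add: reduced_factor_def fps_of_poly_diff fps_of_poly_monom')
qed

lemma coeff_reduced_factor:
  assumes "k > 0" "m > 0"
  shows "coeff (reduced_factor m k) 0 \<noteq> 0"
proof -
  have "fps_nth (1 - fps_X ^ k :: complex fps) 0 = 1" using assms by (simp add: fps_X_power_nth)
  then show ?thesis unfolding one_minus_power_factor[of k m] by auto
qed

lemma poly_reduced_factor:
  assumes "primitive_root_of_unity m w" "m > 0"
  shows "poly (reduced_factor m k) w = (if m dvd k then of_nat (k div m) else 1 - w ^ k)"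
  using assms by (simp add: reduced_factor_def poly_sum poly_monom power_mult primitive_root_of_unity_def)

text \<open>Each block of \<open>m\<close> consecutive indices contributes \<open>\<Prod>\<^sub>j (1 - w\<^sup>j) = m\<close> from its non-multiples of
  \<open>m\<close>, and the \<open>t\<close>-th block contributes \<open>t\<close> from its multiple.\<close>
lemma prod_reduced_factor:
  assumes w: "primitive_root_of_unity m w" and m: "m > 0"
  shows "(\<Prod>k\<in>{1..d * m}. poly (reduced_factor m k) w) = of_nat (fact d * m ^ d)"
proof (induction d)
  case (Suc d)
  have wm: "w ^ (d * m) = 1" using primitive_root_power_eq_1_iff[OF w m] by simp
  have "(\<Prod>k\<in>{1..Suc d * m}. poly (reduced_factor m k) w) =
      (\<Prod>k\<in>{1..d * m}. poly (reduced_factor m k) w) * (\<Prod>k\<in>{d * m + 1..d * m + m}. poly (reduced_factor m k) w)"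
    using prod.ub_add_nat[of 1 "d * m" _ m] by (simp add: add.commute)
  also have "(\<Prod>k\<in>{d * m + 1..d * m + m}. poly (reduced_factor m k) w) =
      (\<Prod>k\<in>{1..m}. poly (reduced_factor m (k + d * m)) w)"
    using prod.shift_bounds_cl_nat_ivl[of "\<lambda>k. poly (reduced_factor m k) w" 1 "d * m" m] by (simp add: add.commute)
  also have "{1..m} = insert m {1..<m}" using m by auto
  also have "(\<Prod>k\<in>insert m {1..<m}. poly (reduced_factor m (k + d * m)) w) = of_nat (Suc d) * (\<Prod>k\<in>{1..<m}. 1 - w ^ k)"
  proof -
    have "(\<Prod>k\<in>{1..<m}. poly (reduced_factor m (k + d * m)) w) = (\<Prod>k\<in>{1..<m}. 1 - w ^ k)"
    proof (rule prod.cong[OF refl])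
      fix k assume "k \<in> {1..<m}"
      then have "\<not> m dvd k" by (auto dest: dvd_imp_le)
      then show "poly (reduced_factor m (k + d * m)) w = 1 - w ^ k"
        by (simp add: poly_reduced_factor[OF w m] power_add wm)
    qed
    moreover have "poly (reduced_factor m (m + d * m)) w = of_nat (Suc d)"
      using m by (simp add: poly_reduced_factor[OF w m] div_mult_self3 flip: mult_Suc)
    ultimately show ?thesis by simp
  qed
  finally show ?case
    unfolding Suc.IH prod_one_minus_roots_of_unity[OF w m] by (simp add: algebra_simps)
qed simp

lemma multiples_in_list:
  fixes xs :: "nat list"
  assumes "0 \<notin> set xs"
  shows "m * length (filter ((dvd) m) xs) \<le> sum_list xs"
    and "m * length (filter ((dvd) m) xs) = sum_list xs \<Longrightarrow> \<forall>k\<in>set xs. k = m"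
proof -
  have "m * length (filter ((dvd) m) xs) \<le> sum_list xs \<and>
      (m * length (filter ((dvd) m) xs) = sum_list xs \<longrightarrow> (\<forall>k\<in>set xs. k = m))"
    using assms
  proof (induction xs)
    case (Cons k xs)
    then have "k > 0" by simp
    then have "m dvd k \<Longrightarrow> m \<le> k" by (auto dest: dvd_imp_le)
    then show ?case using Cons \<open>k > 0\<close> by auto
  qed simp
  then show "m * length (filter ((dvd) m) xs) \<le> sum_list xs"
    "m * length (filter ((dvd) m) xs) = sum_list xs \<Longrightarrow> \<forall>k\<in>set xs. k = m" by auto
qed

text \<open>A part divisible by \<open>m\<close> is at least \<open>m\<close>, so there are at most \<open>d\<close> of them, and if there are \<open>d\<close> then
  each equals \<open>m\<close> and nothing is left for other parts.\<close>
lemma partition_rectangle_iff: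
  assumes \<nu>: "\<nu> \<in> partitions_of (d * m)" and m: "m > 0"
  shows "length (filter ((dvd) m) \<nu>) \<le> d"
    and "length (filter ((dvd) m) \<nu>) = d \<longleftrightarrow> \<nu> = replicate d m"
proof -
  have \<nu>: "0 \<notin> set \<nu>" "sum_list \<nu> = d * m" using \<nu> by (auto simp: partitions_of_def is_partition_def)
  show "length (filter ((dvd) m) \<nu>) \<le> d" using multiples_in_list(1)[OF \<nu>(1), of m] \<nu> m by (simp add: mult.commute)
  show "length (filter ((dvd) m) \<nu>) = d \<longleftrightarrow> \<nu> = replicate d m"
  proof
    assume "length (filter ((dvd) m) \<nu>) = d"
    then have "\<forall>k\<in>set \<nu>. k = m" using multiples_in_list(2)[OF \<nu>(1), of m] \<nu> by simp
    then obtain l where l: "\<nu> = replicate l m" by (metis replicate_length_same)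
    then show "\<nu> = replicate d m" using \<nu>(2) m by (simp add: sum_list_replicate)
  qed simp
qed

lemma prod_multiples:
  fixes Y :: "'a :: comm_monoid_mult"
  assumes "m > 0"
  shows "(\<Prod>k\<in>{1..d * m}. if m dvd k then Y else 1) = Y ^ d"
proof -
  have "{k \<in> {1..d * m}. m dvd k} = (\<lambda>t. t * m) ` {1..d}"
    using assms by (auto elim!: dvdE simp: mult.commute)
  then have "card {k \<in> {1..d * m}. m dvd k} = d"
    using assms by (simp add: card_image inj_on_def)
  then show ?thesis by (simp add: prod.If_cases Int_def)
qed

text \<open>With \<open>e\<close> parts divisible by \<open>m\<close>, the quotient is \<open>(1 - q\<^sup>m)\<^bsup>d-e\<^esup>\<close> times a factor that is regular at
  \<open>w\<close>. It vanishes at \<open>w\<close> unless \<open>e = d\<close>, and in that case all factors of the denominator have been cancelled.\<close>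
lemma has_value_at_term:
  assumes w: "primitive_root_of_unity m w" and m: "m > 0" and \<nu>: "\<nu> \<in> partitions_of (d * m)"
  shows "has_value_at ((\<Prod>k\<in>{1..d * m}. 1 - fps_X ^ k) * (\<Prod>k\<leftarrow>\<nu>. inverse (1 - fps_X ^ k))) w
    (if \<nu> = replicate d m then of_nat (fact d * m ^ d) else 0)"
proof -
  define Y :: "complex fps" where "Y = 1 - fps_X ^ m"
  define e where "e = length (filter ((dvd) m) \<nu>)"
  let ?U = "\<lambda>k. fps_of_poly (reduced_factor m k)"
  have pos: "0 \<notin> set \<nu>" using \<nu> by (auto simp: partitions_of_def is_partition_def)
  have e: "e \<le> d" "e = d \<longleftrightarrow> \<nu> = replicate d m"
    using partition_rectangle_iff[OF \<nu> m] by (auto simp: e_def)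
  have Y: "Y * inverse Y = 1"
    unfolding Y_def using m by (intro inverse_mult_eq_1') (simp add: fps_X_power_nth)
  have factor: "1 - fps_X ^ k = (if m dvd k then Y else 1) * ?U k" for k
    unfolding Y_def by (rule one_minus_power_factor)
  have num: "(\<Prod>k\<in>{1..d * m}. 1 - fps_X ^ k) = Y ^ d * (\<Prod>k\<in>{1..d * m}. ?U k)"
    by (simp only: factor prod.distrib prod_multiples[OF m])
  have den: "(\<Prod>k\<leftarrow>\<nu>. inverse (1 - fps_X ^ k)) = inverse Y ^ e * (\<Prod>k\<leftarrow>\<nu>. inverse (?U k))"
    unfolding e_def factor by (induction \<nu>) (simp_all add: fps_inverse_mult mult_ac)
  have "Y ^ d * inverse Y ^ e = Y ^ (d - e) * (Y * inverse Y) ^ e"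
    using e(1) by (simp add: power_mult_distrib mult.assoc[symmetric] flip: power_add)
  then have eq: "(\<Prod>k\<in>{1..d * m}. 1 - fps_X ^ k) * (\<Prod>k\<leftarrow>\<nu>. inverse (1 - fps_X ^ k)) =
      Y ^ (d - e) * (\<Prod>k\<in>{1..d * m}. ?U k) * (\<Prod>k\<leftarrow>\<nu>. inverse (?U k))"
    unfolding num den Y by (simp add: mult_ac)
  have "has_value_at Y w (poly (1 - monom 1 m) w)"
    using has_value_at_poly[of "1 - monom 1 m" w] by (simp add: Y_def fps_of_poly_diff fps_of_poly_monom')
  then have "has_value_at Y w 0"
    using w by (simp add: poly_monom primitive_root_of_unity_def)
  moreover have "has_value_at (inverse (?U k)) w (inverse (poly (reduced_factor m k) w))" if "k \<in> set \<nu>" for k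
  proof (rule has_value_at_inverse)
    have "k > 0" using that pos by (metis gr0I)
    then show "coeff (reduced_factor m k) 0 \<noteq> 0" using m by (rule coeff_reduced_factor)
    have "w ^ k \<noteq> 1" if "\<not> m dvd k" using that primitive_root_power_eq_1_iff[OF w m] by simp
    then show "poly (reduced_factor m k) w \<noteq> 0"
      using \<open>k > 0\<close> m by (auto simp: poly_reduced_factor[OF w m] elim!: dvdE)
  qed
  ultimately have "has_value_at (Y ^ (d - e) * (\<Prod>k\<in>{1..d * m}. ?U k) * (\<Prod>k\<leftarrow>\<nu>. inverse (?U k))) w
      (0 ^ (d - e) * (\<Prod>k\<in>{1..d * m}. poly (reduced_factor m k) w) *
        (\<Prod>k\<leftarrow>\<nu>. inverse (poly (reduced_factor m k) w)))"
    by (intro has_value_at_mult has_value_at_power has_value_at_prod has_value_at_prod_list has_value_at_poly)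
  also have "0 ^ (d - e) * (\<Prod>k\<in>{1..d * m}. poly (reduced_factor m k) w) *
        (\<Prod>k\<leftarrow>\<nu>. inverse (poly (reduced_factor m k) w)) =
      (if \<nu> = replicate d m then of_nat (fact d * m ^ d) else 0)"
  proof (cases "\<nu> = replicate d m")
    case True
    have "(\<Prod>k\<leftarrow>\<nu>. inverse (poly (reduced_factor m k) w)) = 1"
      using m unfolding True by (simp add: poly_reduced_factor[OF w m])
    then show ?thesis using True e by (simp only: prod_reduced_factor[OF w m]) simp
  next
    case False
    then have "d - e > 0" using e by simp
    then show ?thesis using False by simp
  qed
  finally show ?thesis unfolding eq .
qed

section \<open>Character values on rectangles\<close>

text \<open>The defining property of the skew characters holds because some coefficients satisfy it.\<close>
lemma skew_char_power_sum:
  assumes "skew_shape lam mu"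
  shows "skew_schur lam mu = (\<lambda>\<alpha>. \<Sum>\<nu>\<in>partitions_of (card (skew_diagram lam mu)).
     skew_char lam mu \<nu> * power_sum_partition \<nu> \<alpha> / of_nat (z \<nu>))"
proof -
  interpret skew_tableaux lam mu by unfold_locales (rule assms)
  let ?n = "card (skew_diagram lam mu)"
  have "sum_mset (exponents \<alpha>) = ?n" if "skew_schur lam mu \<alpha> \<noteq> 0" for \<alpha>
  proof -
    have "{T \<in> SSYT lam mu. tableau_monomial lam mu T = \<alpha>} \<noteq> {}"
      using that unfolding skew_schur_def by (metis card.empty of_nat_0)
    then obtain T where T: "T \<in> SSYT lam mu" "\<alpha> = tableau_monomial lam mu T" by blast
    have fin: "finite (skew_diagram lam mu)" by (rule finite_skew_diagram)
    have keys: "Poly_Mapping.keys \<alpha> = T ` skew_diagram lam mu"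
      using fin by (auto simp: T(2) in_keys_iff lookup_tableau_monomial) blast
    have "sum_mset (exponents \<alpha>) = (\<Sum>k\<in>T ` skew_diagram lam mu. card {b \<in> skew_diagram lam mu. T b = k})"
      unfolding exponents_def keys sum_unfold_sum_mset[symmetric]
      by (simp add: T(2) lookup_tableau_monomial)
    also have "\<dots> = ?n"
      using sum.image_gen[OF fin, of "\<lambda>_. 1 :: nat" T] by simp
    finally show ?thesis .
  qed
  then have "skew_schur lam mu \<in> power_sum_span ?n"
    by (intro symmetric_series_power_sum_span symmetric_seriesI_adjacent
        skew_schur_adjacent_transposition)
  then obtain \<chi> where \<chi>: "skew_schur lam mu = (\<lambda>\<alpha>. \<Sum>\<nu>\<in>partitions_of ?n. \<chi> \<nu> * power_sum_partition \<nu> \<alpha>)"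
    by (auto simp: power_sum_span_def)
  have z: "z \<nu> \<noteq> 0" if "\<nu> \<in> partitions_of ?n" for \<nu>
    using that by (auto simp: z_def partitions_of_def is_partition_def)
  have cancel: "\<chi> \<nu> * x = (\<chi> \<nu> * of_nat (z \<nu>)) * x / of_nat (z \<nu>)"
    if "\<nu> \<in> partitions_of ?n" for \<nu> and x :: complex
    using z[OF that] by simp
  have expansion: "skew_schur lam mu = (\<lambda>\<alpha>. \<Sum>\<nu>\<in>partitions_of ?n.
      (\<chi> \<nu> * of_nat (z \<nu>)) * power_sum_partition \<nu> \<alpha> / of_nat (z \<nu>))"
    unfolding \<chi> by (intro ext sum.cong refl cancel)
  have "\<exists>\<chi>. skew_schur lam mu =
      (\<lambda>\<alpha>. \<Sum>\<nu>\<in>partitions_of ?n. \<chi> \<nu> * power_sum_partition \<nu> \<alpha> / of_nat (z \<nu>))"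
    by (rule exI[where x = "\<lambda>\<nu>. \<chi> \<nu> * of_nat (z \<nu>)"]) (rule expansion)
  then show ?thesis unfolding skew_char_def by (rule someI_ex)
qed

text \<open>Both sides of the power sum expansion are specialized and multiplied by \<open>(1 - q) \<dots> (1 - q\<^sup>n)\<close>. The
  left-hand side is then a polynomial, whose value at \<open>w\<close> is computed term by term on the right.\<close>
lemma skew_char_eq_comaj:
  assumes shape: "skew_shape lam mu" and n: "card (skew_diagram lam mu) = d * m" and m: "m > 0"
    and w: "primitive_root_of_unity m w"
  shows "skew_char lam mu (replicate d m) = (\<Sum>S\<in>SYT lam mu. w ^ comaj lam mu S)"
proof -
  interpret skew_tableaux lam mu by unfold_locales (rule shape)
  let ?n = "d * m" and ?\<chi> = "skew_char lam mu"
  let ?A = "\<Prod>k\<in>{1..?n}. 1 - fps_X ^ k :: complex fps"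
  let ?B = "\<lambda>\<nu>. \<Prod>k\<leftarrow>\<nu>. inverse (1 - fps_X ^ k :: complex fps)"
  let ?F = "\<Sum>S\<in>SYT lam mu. monom 1 (comaj lam mu S) :: complex poly"
  have schur: "skew_schur lam mu = (\<lambda>\<alpha>. \<Sum>\<nu>\<in>partitions_of ?n. ?\<chi> \<nu> / of_nat (z \<nu>) * power_sum_partition \<nu> \<alpha>)"
    using skew_char_power_sum[OF shape] by (simp add: n)
  have denom: "(\<Prod>j<?n. inverse (1 - fps_X ^ (?n - j))) * ?A = (1 :: complex fps)"
  proof -
    have "(\<Prod>j<?n. inverse (1 - fps_X ^ (?n - j))) = (\<Prod>k\<in>{1..?n}. inverse (1 - fps_X ^ k) :: complex fps)"
      by (rule prod.reindex_bij_witness[where i = "\<lambda>k. ?n - k" and j = "\<lambda>j. ?n - j"]) auto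
    then have "(\<Prod>j<?n. inverse (1 - fps_X ^ (?n - j))) * ?A =
        (\<Prod>k\<in>{1..?n}. inverse (1 - fps_X ^ k) * (1 - fps_X ^ k) :: complex fps)"
      by (simp only: prod.distrib)
    also have "\<dots> = 1"
      by (intro prod.neutral ballI inverse_mult_eq_1) (simp add: fps_X_power_nth)
    finally show ?thesis .
  qed
  have "fps_X ^ ?n * fps_of_poly ?F = (\<Sum>S\<in>SYT lam mu. fps_X ^ (?n + comaj lam mu S)) * 1"
    by (simp add: fps_of_poly_sum fps_of_poly_monom' sum_distrib_left power_add)
  also have "\<dots> = (\<Sum>S\<in>SYT lam mu. fps_X ^ (?n + comaj lam mu S)) *
      ((\<Prod>j<?n. inverse (1 - fps_X ^ (?n - j))) * ?A)"
    by (simp only: denom)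
  also have "\<dots> = specialize (skew_schur lam mu) * ?A"
    by (simp only: specialize_skew_schur_SYT n mult.assoc)
  also have "specialize (skew_schur lam mu) =
      (\<Sum>\<nu>\<in>partitions_of ?n. fps_const (?\<chi> \<nu> / of_nat (z \<nu>)) * (fps_X ^ ?n * ?B \<nu>))"
    unfolding schur specialize_lincomb
    by (intro sum.cong) (auto simp: partitions_of_def is_partition_def specialize_power_sum_partition)
  also have "\<dots> * ?A = fps_X ^ ?n * (\<Sum>\<nu>\<in>partitions_of ?n. fps_const (?\<chi> \<nu> / of_nat (z \<nu>)) * (?A * ?B \<nu>))"
    unfolding sum_distrib_left sum_distrib_right by (intro sum.cong refl) (simp only: mult_ac)
  finally have F: "fps_of_poly ?F =
      (\<Sum>\<nu>\<in>partitions_of ?n. fps_const (?\<chi> \<nu> / of_nat (z \<nu>)) * (?A * ?B \<nu>))"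
    by simp
  have "has_value_at (fps_of_poly ?F) w (\<Sum>\<nu>\<in>partitions_of ?n.
      ?\<chi> \<nu> / of_nat (z \<nu>) * (if \<nu> = replicate d m then of_nat (fact d * m ^ d) else 0))"
    unfolding F by (intro has_value_at_sum has_value_at_mult has_value_at_const has_value_at_term[OF w m])
  then have "poly ?F w = (\<Sum>\<nu>\<in>partitions_of ?n.
      ?\<chi> \<nu> / of_nat (z \<nu>) * (if \<nu> = replicate d m then of_nat (fact d * m ^ d) else 0))"
    by (rule has_value_at_unique)
  also have "\<dots> = (\<Sum>\<nu>\<in>partitions_of ?n. if \<nu> = replicate d m then ?\<chi> \<nu> else 0)"
  proof (intro sum.cong refl)
    fix \<nu>
    have "z (replicate d m) = fact d * m ^ d"
    proof -
      have "count_list (replicate d m) m = d" by (induction d) auto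
      then show ?thesis by (cases "d = 0") (simp_all add: z_def)
    qed
    then show "?\<chi> \<nu> / of_nat (z \<nu>) * (if \<nu> = replicate d m then of_nat (fact d * m ^ d) else 0) =
        (if \<nu> = replicate d m then ?\<chi> \<nu> else 0)" using m by simp
  qed
  also have "\<dots> = ?\<chi> (replicate d m)"
    using m by (simp add: finite_partitions_of)
      (auto simp: partitions_of_def is_partition_def sum_list_replicate sorted_wrt_iff_nth_less)
  finally show ?thesis by (simp add: poly_sum poly_monom)
qed

lemma comaj_plus_maj:
  "comaj lam mu S + maj lam mu S = card (skew_diagram lam mu) * card (descents lam mu S)"
proof -
  have "comaj lam mu S + maj lam mu S = (\<Sum>j\<in>descents lam mu S. card (skew_diagram lam mu) - j + j)"
    by (simp add: comaj_def maj_def sum.distrib)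
  also have "\<dots> = (\<Sum>j\<in>descents lam mu S. card (skew_diagram lam mu))"
    by (intro sum.cong) (auto simp: descents_def)
  finally show ?thesis by simp
qed

lemma primitive_root_power:
  assumes "primitive_root_of_unity (d * m) \<xi>" "d > 0" "m > 0"
  shows "primitive_root_of_unity m (inverse (\<xi> ^ d))"
  using assms primitive_root_power_eq_1_iff[OF assms(1)]
  by (auto simp: primitive_root_of_unity_def power_inverse dest!: dvd_imp_le simp flip: power_mult)

theorem proposition11:
  fixes lam mu :: "nat list" and n d m :: nat and \<xi> :: complex
  assumes "skew_shape lam mu"
    and "card (skew_diagram lam mu) = n"
    and "n \<ge> 1"
    and "primitive_root_of_unity n \<xi>"
    and "d > 0" and "m > 0" and "n = d * m"
  shows "skew_char lam mu (replicate d m) = f_skew lam mu (\<xi> ^ d)"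
proof -
  let ?q = "\<xi> ^ d"
  have \<xi>: "primitive_root_of_unity (d * m) \<xi>" using assms by simp
  have "skew_char lam mu (replicate d m) = (\<Sum>S\<in>SYT lam mu. inverse ?q ^ comaj lam mu S)"
    by (rule skew_char_eq_comaj) (use assms primitive_root_power[OF \<xi>] in auto)
  also have "\<dots> = (\<Sum>S\<in>SYT lam mu. ?q ^ maj lam mu S)"
  proof (rule sum.cong[OF refl])
    fix S
    have "?q ^ n = (\<xi> ^ n) ^ d" by (simp add: mult.commute flip: power_mult)
    then have "?q ^ n = 1" using assms(4) by (simp add: primitive_root_of_unity_def)
    then have "?q ^ (comaj lam mu S + maj lam mu S) = 1"
      using assms(2) by (simp add: comaj_plus_maj power_mult)
    then have "?q ^ comaj lam mu S * ?q ^ maj lam mu S = 1" by (simp add: power_add)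
    then show "inverse ?q ^ comaj lam mu S = ?q ^ maj lam mu S"
      by (metis inverse_unique power_inverse)
  qed
  finally show ?thesis by (simp add: f_skew_def)
qed

end
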